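(* Let $d\ge1$ and let $A$ be a $d\times d$ integer matrix which is diagonalizable over $\mathbb{Q}$ and whose eigenvalues $\lambda_1,\dots,\lambda_d$ (counted with multiplicity) are all integers, with $1<|\lambda_1|\le|\lambda_2|\le\dots\le|\lambda_d|$. Let $T\colon\mathbb{T}^d\to\mathbb{T}^d$ be $Tx=Ax\pmod 1$. Let $\psi\colon\mathbb{N}\to(0,\infty)$ be a decreasing function with $\psi(n)\to0$ as $n\to\infty$, and let $\alpha=\liminf_{n\to\infty}\frac{-\log\psi(n)}{n}\in[0,\infty]$. Then, for every value $\alpha\ge0$, $$\dim_{\rm H}R(\psi)=\min_{1\le j\le d}\left\{\frac{j\log|\lambda_j|+\sum_{i\in\mathcal{K}(j)}\bigl(\alpha+\log|\lambda_j|-\log|\lambda_i|\bigr)+\sum_{i=j+1}^d\log|\lambda_i|}{\alpha+\log|\lambda_j|}\right\},$$ where $\mathcal{K}(j)=\{i\in\{1,\dots,d\} : \log|\lambda_i|>\log|\lambda_j|+\alpha\}$.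
   Context: $\mathbb{T}^d=\mathbb{R}^d/\mathbb{Z}^d$ is the $d$-dimensional torus with the usual quotient distance, and $B(x,r)$ is the ball with centre $x$ and radius $r$ in this distance. The recurrence set is $R(\psi)=\{x\in\mathbb{T}^d : T^n x\in B(x,\psi(n))\text{ for infinitely many }n\ge1\}$. $\dim_{\rm H}$ denotes Hausdorff dimension. An empty sum is $0$. When $\alpha=\infty$, each $\mathcal{K}(j)$ is empty and the right-hand side is interpreted as $0$. *)

theory Defs
  imports "HOL-Analysis.Analysis" "HOL-Computational_Algebra.Polynomial"
begin

definition int_lattice :: "(real ^ 'n) set" where
  "int_lattice = {k. \<forall>i. k $ i \<in> \<int>}"

lemma int_lattice_0 [simp]: "0 \<in> int_lattice"
  by (simp add: int_lattice_def)

lemma int_lattice_add: "k \<in> int_lattice \<Longrightarrow> l \<in> int_lattice \<Longrightarrow> k + l \<in> int_lattice"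
  by (simp add: int_lattice_def)

lemma int_lattice_uminus: "k \<in> int_lattice \<Longrightarrow> - k \<in> int_lattice"
  by (simp add: int_lattice_def)

lemma int_lattice_diff: "k \<in> int_lattice \<Longrightarrow> l \<in> int_lattice \<Longrightarrow> k - l \<in> int_lattice"
  by (simp add: int_lattice_def)

lemma int_lattice_norm_ge_1:
  assumes "k \<in> int_lattice" "k \<noteq> 0"
  shows "1 \<le> norm k"
proof -
  obtain i where i: "k $ i \<noteq> 0"
    using assms(2) by (auto simp: vec_eq_iff)
  have "1 \<le> \<bar>k $ i\<bar>"
    using assms(1) i by (auto simp: int_lattice_def intro: Ints_nonzero_abs_ge1)
  also have "\<dots> \<le> norm k"
    by (rule component_le_norm_cart)
  finally show ?thesis .
qed

quotient_type (overloaded) 'n torus =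
  "real ^ 'n" / "\<lambda>x y. x - y \<in> int_lattice"
  morphisms rep_torus torus_of
proof (rule equivpI)
  show "reflp (\<lambda>x y :: real ^ 'n. x - y \<in> int_lattice)"
    by (simp add: reflp_def)
  show "symp (\<lambda>x y :: real ^ 'n. x - y \<in> int_lattice)"
    using int_lattice_uminus by (fastforce simp: symp_def)
  show "transp (\<lambda>x y :: real ^ 'n. x - y \<in> int_lattice)"
    unfolding transp_def using int_lattice_add by fastforce
qed

lemma torus_of_eq_iff: "torus_of x = torus_of y \<longleftrightarrow> x - y \<in> int_lattice"
  by (rule torus.abs_eq_iff)

lemma torus_of_surj: "\<exists>x. X = torus_of x"
  by (metis Quotient3_abs_rep Quotient3_torus)

instantiation torus :: (finite) metric_space
begin

definition dist_torus :: "'a torus \<Rightarrow> 'a torus \<Rightarrow> real" where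
  "dist_torus X Y = (INF (x, y) \<in> {(x, y). torus_of x = X \<and> torus_of y = Y}. dist x y)"

definition uniformity_torus :: "('a torus \<times> 'a torus) filter" where
  "uniformity_torus = (INF e\<in>{0<..}. principal {(X, Y). dist X Y < e})"

definition open_torus :: "'a torus set \<Rightarrow> bool" where
  "open_torus U = (\<forall>X\<in>U. \<forall>\<^sub>F (X', Y) in uniformity. X' = X \<longrightarrow> Y \<in> U)"

lemma torus_dist_le:
  "torus_of x = X \<Longrightarrow> torus_of y = Y \<Longrightarrow> dist X Y \<le> dist x y"
  unfolding dist_torus_def
  by (rule cINF_lower2[where x = "(x, y)"]) (auto intro!: bdd_belowI2[where m = 0])

lemma torus_dist_lessE:
  assumes "dist (torus_of x) Y < e"
  obtains y where "torus_of y = Y" "dist x y < e"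
proof -
  let ?S = "{(a, b). torus_of a = torus_of x \<and> torus_of b = Y}"
  have "?S \<noteq> {}"
    using torus_of_surj[of Y] by auto
  moreover have "bdd_below ((\<lambda>(a, b). dist a b) ` ?S)"
    by (auto intro!: bdd_belowI2[where m = 0])
  ultimately obtain a b where ab: "torus_of a = torus_of x" "torus_of b = Y" "dist a b < e"
    using assms unfolding dist_torus_def by (auto simp: cINF_less_iff)
  have "a - x \<in> int_lattice"
    using ab(1) by (simp add: torus_of_eq_iff)
  then have "torus_of (b - (a - x)) = Y"
    using ab(2) int_lattice_uminus[of "a - x"] by (auto simp: torus_of_eq_iff)
  moreover have "dist x (b - (a - x)) = dist a b"
    by (simp add: dist_norm algebra_simps)
  ultimately show ?thesis
    using that ab(3) by metis
qed

instance
proof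
  fix X Y Z :: "'a torus"
  show "uniformity = (INF e\<in>{0<..}. principal {(X :: 'a torus, Y). dist X Y < e})"
    by (rule uniformity_torus_def)
  show "open U = (\<forall>X\<in>U. \<forall>\<^sub>F (X', Y) in uniformity. X' = X \<longrightarrow> Y \<in> U)" for U :: "'a torus set"
    by (rule open_torus_def)
  have tri: "dist X Z \<le> dist X Y + dist Y Z" for X Y Z :: "'a torus"
  proof (rule field_le_epsilon)
    fix e :: real assume e: "e > 0"
    obtain x where x: "X = torus_of x" using torus_of_surj by metis
    have "dist (torus_of x) Y < dist X Y + e / 2" using e x by simp
    then obtain y where y: "torus_of y = Y" "dist x y < dist X Y + e / 2"
      by (rule torus_dist_lessE)
    have "dist (torus_of y) Z < dist Y Z + e / 2" using e y by simp
    then obtain z where z: "torus_of z = Z" "dist y z < dist Y Z + e / 2"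
      by (rule torus_dist_lessE)
    have "dist X Z \<le> dist x z" using x z by (intro torus_dist_le) auto
    also have "\<dots> \<le> dist x y + dist y z" by (rule dist_triangle)
    finally show "dist X Z \<le> dist X Y + dist Y Z + e" using y z by simp
  qed
  have sym: "dist X Y \<le> dist Y X" for X Y :: "'a torus"
  proof (rule field_le_epsilon)
    fix e :: real assume e: "e > 0"
    obtain y where y: "Y = torus_of y" using torus_of_surj by metis
    have "dist (torus_of y) X < dist Y X + e" using e y by simp
    then obtain x where x: "torus_of x = X" "dist y x < dist Y X + e"
      by (rule torus_dist_lessE)
    have "dist X Y \<le> dist x y" using x y by (intro torus_dist_le) auto
    then show "dist X Y \<le> dist Y X + e" using x by (simp add: dist_commute)
  qed
  show "dist X Y \<le> dist X Z + dist Y Z"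
    using tri[of X Y Z] sym[of Z Y] by linarith
  show "dist X Y = 0 \<longleftrightarrow> X = Y"
  proof
    assume "X = Y"
    obtain x where x: "torus_of x = X" using torus_of_surj by metis
    have "dist X X \<le> 0"
      using torus_dist_le[OF x x] by simp
    moreover have "0 \<le> dist X X"
      using tri[of X X X] by linarith
    ultimately show "dist X Y = 0" using \<open>X = Y\<close> by simp
  next
    assume 0: "dist X Y = 0"
    obtain x where x: "X = torus_of x" using torus_of_surj by metis
    obtain y where y: "torus_of y = Y" "dist x y < 1/2"
      using torus_dist_lessE[of x Y "1/2"] 0 x by auto
    show "X = Y"
    proof (rule ccontr)
      assume "X \<noteq> Y"
      then have "dist x y > 0" using x y by auto
      then obtain z where z: "torus_of z = Y" "dist x z < dist x y"
        using torus_dist_lessE[of x Y "dist x y"] 0 x by auto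
      have "y - z \<in> int_lattice" "y - z \<noteq> 0"
        using y z torus_of_eq_iff[of y z] by auto
      then have "1 \<le> dist y z"
        unfolding dist_norm by (rule int_lattice_norm_ge_1)
      also have "\<dots> \<le> dist x y + dist x z"
        using dist_triangle2[of y z x] by (simp add: dist_commute)
      finally show False using y z by simp
    qed
  qed
qed

end

lift_definition torus_map :: "int ^ 'n ^ 'n \<Rightarrow> 'n :: finite torus \<Rightarrow> 'n torus" is
  "\<lambda>A x. map_matrix real_of_int A *v x"
proof -
  fix A :: "int ^ 'n ^ 'n" and x y :: "real ^ 'n"
  assume "x - y \<in> int_lattice"
  then have "map_matrix real_of_int A *v (x - y) \<in> int_lattice"
    by (auto simp: int_lattice_def matrix_vector_mult_def map_matrix_def
        simp del: vector_minus_component intro!: Ints_sum)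
  then show "map_matrix real_of_int A *v x - map_matrix real_of_int A *v y \<in> int_lattice"
    by (simp add: matrix_vector_mult_diff_distrib)
qed

definition recurrence_set :: "('a :: metric_space \<Rightarrow> 'a) \<Rightarrow> (nat \<Rightarrow> real) \<Rightarrow> 'a set" where
  "recurrence_set T psi = {x. infinite {n. n \<ge> 1 \<and> (T ^^ n) x \<in> ball x (psi n)}}"

text \<open>The case \<open>s = 0\<close> is separate because \<open>0 powr 0 = 0\<close>, whereas a nonempty set must contribute
  \<open>1\<close> to the zero-dimensional (counting) measure.\<close>

definition diam_powr :: "real \<Rightarrow> 'a :: metric_space set \<Rightarrow> ennreal" where
  "diam_powr s U =
    (if U = {} then 0 else if s = 0 then 1 else ennreal (diameter U powr s))"

text \<open>Boundedness of the covering sets is required explicitly because \<^const>\<open>diameter\<close> has no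
  meaningful value on unbounded sets.\<close>

definition hausdorff_premeasure :: "real \<Rightarrow> real \<Rightarrow> 'a :: metric_space set \<Rightarrow> ennreal" where
  "hausdorff_premeasure s \<delta> E =
    (INF U \<in> {U :: nat \<Rightarrow> 'a set. E \<subseteq> (\<Union>i. U i) \<and> (\<forall>i. bounded (U i) \<and> diameter (U i) \<le> \<delta>)}.
      \<Sum>i. diam_powr s (U i))"

definition hausdorff_measure :: "real \<Rightarrow> 'a :: metric_space set \<Rightarrow> ennreal" where
  "hausdorff_measure s E = (SUP \<delta>\<in>{0<..}. hausdorff_premeasure s \<delta> E)"

definition hausdorff_dim :: "'a :: metric_space set \<Rightarrow> ereal" where
  "hausdorff_dim E = Inf (ereal ` {s. 0 \<le> s \<and> hausdorff_measure s E = 0})"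

definition diagonalizable :: "'a :: field ^ 'n ^ 'n \<Rightarrow> bool" where
  "diagonalizable M \<longleftrightarrow>
    (\<exists>P D :: 'a ^ 'n ^ 'n. invertible P \<and> (\<forall>i j. i \<noteq> j \<longrightarrow> D $ i $ j = 0) \<and> M = P ** D ** matrix_inv P)"

definition charpoly :: "'a :: comm_ring_1 ^ 'n ^ 'n \<Rightarrow> 'a poly" where
  "charpoly M = det (mat [:0, 1:] - map_matrix (\<lambda>a. [:a:]) M)"

definition K_set :: "nat \<Rightarrow> (nat \<Rightarrow> int) \<Rightarrow> ereal \<Rightarrow> nat \<Rightarrow> nat set" where
  "K_set d lam \<alpha> j =
    {i \<in> {1..d}. ereal (ln \<bar>real_of_int (lam i)\<bar>) > ereal (ln \<bar>real_of_int (lam j)\<bar>) + \<alpha>}"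

text \<open>The quotient is taken in the extended reals. For \<open>\<alpha> = \<infinity>\<close> every \<^const>\<open>K_set\<close> is empty
  and the denominator is \<open>\<infinity>\<close>, so the value is \<open>0\<close> because \<open>x / \<infinity> = 0\<close> there.\<close>

definition dim_term :: "nat \<Rightarrow> (nat \<Rightarrow> int) \<Rightarrow> ereal \<Rightarrow> nat \<Rightarrow> ereal" where
  "dim_term d lam \<alpha> j =
    (ereal (real j * ln \<bar>real_of_int (lam j)\<bar>)
      + (\<Sum>i\<in>K_set d lam \<alpha> j.
          \<alpha> + ereal (ln \<bar>real_of_int (lam j)\<bar>) - ereal (ln \<bar>real_of_int (lam i)\<bar>))
      + (\<Sum>i = j + 1..d. ereal (ln \<bar>real_of_int (lam i)\<bar>)))
    / (\<alpha> + ereal (ln \<bar>real_of_int (lam j)\<bar>))"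

lemma dim_term_infinity: "dim_term d lam \<infinity> j = 0"
  by (simp add: dim_term_def)

lemma dim_term_real:
  assumes "0 \<le> a" "1 < \<bar>lam j\<bar>"
  shows "dim_term d lam (ereal a) j =
    ereal ((real j * ln \<bar>real_of_int (lam j)\<bar>
      + (\<Sum>i\<in>{i \<in> {1..d}. ln \<bar>real_of_int (lam i)\<bar> > ln \<bar>real_of_int (lam j)\<bar> + a}.
          a + ln \<bar>real_of_int (lam j)\<bar> - ln \<bar>real_of_int (lam i)\<bar>)
      + (\<Sum>i = j + 1..d. ln \<bar>real_of_int (lam i)\<bar>))
    / (a + ln \<bar>real_of_int (lam j)\<bar>))"
proof -
  have "1 < \<bar>real_of_int (lam j)\<bar>"
    using assms(2) by linarith
  then have "a + ln \<bar>real_of_int (lam j)\<bar> \<noteq> 0"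
    using assms(1) by (smt (verit) ln_gt_zero)
  then show ?thesis
    by (simp add: dim_term_def K_set_def)
qed

end

theory Submission
  imports Defs
begin

text \<open>
Diagonalizing \<open>A\<close> by matrices with integer entries (\<open>integer_eigenbases\<close>) replaces the torus map by
the multiplications \<open>y\<^sub>i \<mapsto> \<mu>\<^sub>i y\<^sub>i\<close> with the eigenvalues \<open>\<mu>\<^sub>i\<close>, and makes the condition
\<open>T\<^sup>n x \<in> B(x, \<psi>(n))\<close> comparable, up to constant factors in the radius, with the requirement that
every \<open>(\<mu>\<^sub>i\<^sup>n - 1) y\<^sub>i\<close> lies within \<open>\<psi>(n)\<close> of an integer. So the points recurring at time \<open>n\<close> form a union of
boxes around periodic points; in coordinate \<open>i\<close> they are spaced \<open>\<bar>\<mu>\<^sub>i\<bar>\<^sup>-\<^sup>n\<close> apart and have side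
\<open>\<psi>(n) \<bar>\<mu>\<^sub>i\<bar>\<^sup>-\<^sup>n\<close>. Write \<open>l\<^sub>i = ln \<bar>\<mu>\<^sub>i\<bar>\<close> and suppose \<open>\<psi>(n) = exp (- a n)\<close>. Intervals of length
\<open>exp (- u n)\<close> that cover coordinate \<open>i\<close> of this union number about \<open>exp (n g\<^sub>i(u))\<close> with
\<open>g\<^sub>i(u) = max (min u l\<^sub>i) (u - a)\<close>, the function \<open>mass_exponent\<close>. Let \<open>G = \<Sum>\<^sub>i g\<^sub>i\<close>. The number in the theorem is
\<open>S = min\<^sub>j G(l\<^sub>j + a) / (l\<^sub>j + a)\<close> at \<open>a = \<alpha>\<close> (\<open>dim_numerator_eq\<close>).

Upper bound (\<open>recurrent_points_null\<close>). For each \<open>j\<close>, cover the boxes of time \<open>n\<close> by cubes of side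
\<open>exp (- n (l\<^sub>j + t))\<close>, which is about the side of the boxes in coordinate \<open>j\<close>; here \<open>t\<close> is at most \<open>\<alpha>\<close> and
\<open>\<psi>(n) \<le> exp (- t n)\<close> eventually. The sum over \<open>n\<close> of the number of cubes times the \<open>s\<close>-th power of
their size converges once \<open>s (l\<^sub>j + t) > G(l\<^sub>j + t)\<close>, so the limsup set is null (\<open>hausdorff_cantelli\<close>).

Lower bound (\<open>recurrent_cantor_set\<close>). For \<open>a > \<alpha>\<close> there are infinitely many times with
\<open>\<psi>(n) \<ge> exp (- a n)\<close>. Choose from them a sequence \<open>n\<^sub>k\<close> that grows geometrically with a large ratio, and in
each coordinate build a Cantor set whose intervals of level \<open>k\<close> are placed at the \<open>n\<^sub>k\<close>-periodic
points inside the intervals of level \<open>k - 1\<close>. Everything is a product over the coordinates, so the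
proportion of centres in a ball of radius \<open>exp (- n\<^sub>k u)\<close> is at most the product of one-dimensional
proportions, each of order at most \<open>exp (- n\<^sub>k g\<^sub>i(u))\<close>. Between consecutive numbers among \<open>0\<close> and the
\<open>l\<^sub>j + a\<close> all the \<open>g\<^sub>i\<close> are concave, so \<open>G(u) \<ge> S u\<close> for every \<open>u \<ge> 0\<close> once it holds at those
numbers (\<open>mass_exponent_sum_ge\<close>). Hence a ball of radius \<open>r\<close> carries a proportion of order at most \<open>r\<^sup>s\<close>
when \<open>s < S\<close>, and a mass distribution argument that only counts centres in finitely many balls
(\<open>mass_distribution\<close>) gives positive \<open>s\<close>-dimensional measure.

Both bounds depend continuously on the rate, and the rates \<open>t\<close> and \<open>a\<close> may be taken arbitrarily
close to \<open>\<alpha>\<close>, or \<open>t\<close> arbitrarily large when \<open>\<alpha> = \<infinity>\<close>.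
\<close>

section \<open>Hausdorff null sets, covers and mass distributions\<close>

lemma diameter_leI:
  fixes S :: "'a :: metric_space set"
  assumes "0 \<le> \<delta>" "\<And>x y. x \<in> S \<Longrightarrow> y \<in> S \<Longrightarrow> dist x y \<le> \<delta>"
  shows "diameter S \<le> \<delta>"
proof (cases "S = {}")
  case False
  then show ?thesis
    unfolding diameter_def using assms(2) by (auto intro!: cSUP_least)
qed (use assms(1) in simp)

lemma ennreal_term_le_suminf: "f i \<le> (\<Sum>i. f i)" for f :: "nat \<Rightarrow> ennreal"
  using sum_le_suminf[of f "{i}"] by simp

lemma diam_powr_eq: "0 < s \<Longrightarrow> diam_powr s U = ennreal (diameter U powr s)"
  by (simp add: diam_powr_def)

text \<open>
The bound on the diameters disappears: for \<open>s > 0\<close> a cover with a small sum consists of small sets.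
\<close>
lemma hausdorff_null_iff:
  fixes E :: "'a :: metric_space set"
  assumes s: "0 < s"
  shows "hausdorff_measure s E = 0 \<longleftrightarrow>
    (\<forall>e>0. \<exists>U :: nat \<Rightarrow> 'a set. E \<subseteq> (\<Union>i. U i) \<and> (\<forall>i. bounded (U i)) \<and>
       (\<Sum>i. ennreal (diameter (U i) powr s)) < ennreal e)" (is "?L \<longleftrightarrow> ?R")
proof
  assume L: ?L
  then have "hausdorff_premeasure s 1 E = 0"
    by (simp add: hausdorff_measure_def flip: bot_ennreal)
  then have small: "hausdorff_premeasure s 1 E < ennreal e" if "e > 0" for e
    using that by simp
  show ?R
  proof (intro allI impI)
    fix e :: real assume "e > 0"
    then obtain U :: "nat \<Rightarrow> 'a set" where "E \<subseteq> (\<Union>i. U i)" "\<forall>i. bounded (U i)"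
        "(\<Sum>i. diam_powr s (U i)) < ennreal e"
      using small[of e] unfolding hausdorff_premeasure_def INF_less_iff by auto
    then show "\<exists>U :: nat \<Rightarrow> 'a set. E \<subseteq> (\<Union>i. U i) \<and> (\<forall>i. bounded (U i)) \<and>
        (\<Sum>i. ennreal (diameter (U i) powr s)) < ennreal e"
      unfolding diam_powr_eq[OF s] by (intro exI[of _ U] conjI)
  qed
next
  assume R: ?R
  have "hausdorff_premeasure s \<delta> E \<le> ennreal e" if "\<delta> > 0" "e > 0" for \<delta> e :: real
  proof -
    \<comment> \<open>A set of diameter above \<open>\<delta>\<close> alone would contribute more than \<open>\<delta> powr s\<close>.\<close>
    define e' where "e' = min e (\<delta> powr s)"
    have "e' > 0" using that by (simp add: e'_def)
    with R obtain U :: "nat \<Rightarrow> 'a set" where U: "E \<subseteq> (\<Union>i. U i)" "\<And>i. bounded (U i)"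
      "(\<Sum>i. ennreal (diameter (U i) powr s)) < ennreal e'" by meson
    have d: "diameter (U i) \<le> \<delta>" for i
    proof (rule ccontr)
      assume "\<not> diameter (U i) \<le> \<delta>"
      then have "e' \<le> diameter (U i) powr s"
        using that s by (auto simp: e'_def intro!: min.coboundedI2 powr_mono2)
      then have "ennreal e' \<le> ennreal (diameter (U i) powr s)" by (rule ennreal_leI)
      also have "\<dots> \<le> (\<Sum>i. ennreal (diameter (U i) powr s))"
        by (rule ennreal_term_le_suminf)
      finally show False using U(3) leD by blast
    qed
    have "hausdorff_premeasure s \<delta> E \<le> (\<Sum>i. ennreal (diameter (U i) powr s))"
      unfolding hausdorff_premeasure_def
      by (rule INF_lower2[of U]) (use U d in \<open>auto simp: diam_powr_eq[OF s]\<close>)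
    also have "\<dots> \<le> ennreal e'" using U(3) by (rule less_imp_le)
    also have "\<dots> \<le> ennreal e" by (rule ennreal_leI) (simp add: e'_def)
    finally show ?thesis .
  qed
  then have "hausdorff_premeasure s \<delta> E = 0" if "\<delta> > 0" for \<delta>
    using ennreal_le_epsilon[of 0 "hausdorff_premeasure s \<delta> E"] that by simp
  then show ?L by (auto simp: hausdorff_measure_def SUP_eq_iff)
qed

text \<open>
For \<open>s = 0\<close> each nonempty covering set contributes \<open>1\<close>, so only empty sets can occur in a cheap cover.
\<close>
lemma hausdorff_measure_zero_eq_0_iff:
  fixes E :: "'a :: metric_space set"
  shows "hausdorff_measure 0 E = 0 \<longleftrightarrow> E = {}"
proof
  assume L: "hausdorff_measure 0 E = 0"
  then have "hausdorff_premeasure 0 1 E = 0"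
    by (simp add: hausdorff_measure_def flip: bot_ennreal)
  then have "hausdorff_premeasure 0 1 E < 1" by simp
  then obtain U :: "nat \<Rightarrow> 'a set" where U: "E \<subseteq> (\<Union>i. U i)" "(\<Sum>i. diam_powr 0 (U i)) < 1"
    unfolding hausdorff_premeasure_def INF_less_iff by auto
  have "U i = {}" for i
  proof (rule ccontr)
    assume "U i \<noteq> {}"
    then have "1 \<le> (\<Sum>i. diam_powr 0 (U i))"
      using ennreal_term_le_suminf[of "\<lambda>i. diam_powr 0 (U i)" i] by (simp add: diam_powr_def)
    then show False using U by simp
  qed
  then show "E = {}" using U by auto
next
  assume "E = {}"
  have "hausdorff_premeasure 0 \<delta> ({} :: 'a set) = 0" if "\<delta> > 0" for \<delta> :: real
  proof -
    have "hausdorff_premeasure 0 \<delta> ({} :: 'a set) \<le> (\<Sum>i::nat. diam_powr 0 ({} :: 'a set))"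
      unfolding hausdorff_premeasure_def
      by (rule INF_lower2[of "\<lambda>_. {}"]) (use that in auto)
    then show ?thesis by (simp add: diam_powr_def del: subset_empty)
  qed
  then show "hausdorff_measure 0 E = 0" using \<open>E = {}\<close> by (auto simp: hausdorff_measure_def SUP_eq_iff)
qed

lemma hausdorff_null_mono:
  assumes "0 < s" "hausdorff_measure s E = 0" "F \<subseteq> E"
  shows "hausdorff_measure s F = 0"
  using assms(2,3) unfolding hausdorff_null_iff[OF assms(1)] by (meson order_trans)

lemma hausdorff_null_lipschitz_image:
  assumes s: "0 < s" and null: "hausdorff_measure s E = 0" and lip: "C-lipschitz_on E f"
  shows "hausdorff_measure s (f ` E) = 0"
  unfolding hausdorff_null_iff[OF s]
proof (intro allI impI)
  fix e :: real assume e: "e > 0"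
  have C: "C \<ge> 0" using lip by (rule lipschitz_on_nonneg)
  \<comment> \<open>The constant \<open>C + 1\<close> replaces \<open>C\<close> because \<open>C\<close> may be \<open>0\<close>.\<close>
  define K where "K = (C + 1) powr s"
  have K: "K > 0" using C by (simp add: K_def)
  obtain U where U: "E \<subseteq> (\<Union>i. U i)" "\<And>i. bounded (U i)"
      "(\<Sum>i. ennreal (diameter (U i) powr s)) < ennreal (e / K)"
    using null hausdorff_null_iff[OF s, of E] e K by (meson divide_pos_pos)
  define V where "V = (\<lambda>i. f ` (E \<inter> U i))"
  have dist: "dist x y \<le> (C + 1) * diameter (U i)" if "x \<in> V i" "y \<in> V i" for x y i
  proof -
    obtain x' y' where xy: "x = f x'" "y = f y'" "x' \<in> E \<inter> U i" "y' \<in> E \<inter> U i"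
      using \<open>x \<in> V i\<close> \<open>y \<in> V i\<close> by (auto simp: V_def)
    have "dist x y \<le> C * dist x' y'" using lip xy by (auto simp: lipschitz_on_def)
    also have "\<dots> \<le> (C + 1) * diameter (U i)"
      using xy C diameter_bounded_bound[OF U(2)] by (intro mult_mono) auto
    finally show ?thesis .
  qed
  have bV: "bounded (V i)" for i
    using dist[of _ i] unfolding bounded_two_points by blast
  have diam: "diameter (V i) powr s \<le> K * diameter (U i) powr s" for i
  proof -
    have "diameter (V i) \<le> (C + 1) * diameter (U i)"
      by (rule diameter_leI) (use dist C diameter_ge_0[OF U(2)] in auto)
    then have "diameter (V i) powr s \<le> ((C + 1) * diameter (U i)) powr s"
      using s by (intro powr_mono2 diameter_ge_0 bV) auto
    then show ?thesis using C diameter_ge_0[OF U(2)] by (simp add: K_def powr_mult)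
  qed
  have "(\<Sum>i. ennreal (diameter (V i) powr s)) \<le> (\<Sum>i. ennreal K * ennreal (diameter (U i) powr s))"
    using diam K by (intro suminf_le) (auto simp flip: ennreal_mult intro!: ennreal_leI)
  also have "\<dots> = ennreal K * (\<Sum>i. ennreal (diameter (U i) powr s))" by simp
  also have "\<dots> < ennreal K * ennreal (e / K)"
    using U(3) K by (simp add: ennreal_mult_strict_left_mono)
  also have "\<dots> = ennreal e" using K e by (simp flip: ennreal_mult)
  finally have "(\<Sum>i. ennreal (diameter (V i) powr s)) < ennreal e" .
  with bV have "(\<forall>i. bounded (V i)) \<and> (\<Sum>i. ennreal (diameter (V i) powr s)) < ennreal e" by blast
  moreover have "f ` E \<subseteq> (\<Union>i. V i)" using U(1) by (fastforce simp: V_def)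
  ultimately show "\<exists>V. f ` E \<subseteq> (\<Union>i. V i) \<and> (\<forall>i. bounded (V i)) \<and>
      (\<Sum>i. ennreal (diameter (V i) powr s)) < ennreal e" by blast
qed

text \<open>
The Borel--Cantelli argument for limsup sets: the families with index at least \<open>N\<close> cover \<open>E\<close> for
every \<open>N\<close>, and the tails of the convergent series are arbitrarily small.
\<close>
lemma hausdorff_cantelli:
  fixes E :: "'a :: metric_space set" and \<F> :: "nat \<Rightarrow> 'a set set" and D :: "nat \<Rightarrow> real"
  assumes s: "0 < s" and fin: "\<And>n. finite (\<F> n)"
    and bdd: "\<And>n B. B \<in> \<F> n \<Longrightarrow> bounded B" and diam: "\<And>n B. B \<in> \<F> n \<Longrightarrow> diameter B \<le> D n"
    and inf: "\<And>x. x \<in> E \<Longrightarrow> \<exists>\<^sub>F n in sequentially. x \<in> \<Union>(\<F> n)"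
    and summ: "summable (\<lambda>n. real (card (\<F> n)) * D n powr s)"
  shows "hausdorff_measure s E = 0"
  unfolding hausdorff_null_iff[OF s]
proof (intro allI impI)
  fix e :: real assume e: "e > 0"
  define a where "a = (\<lambda>n. real (card (\<F> n)) * D n powr s)"
  have a0: "a n \<ge> 0" for n by (simp add: a_def)
  obtain N where N: "(\<Sum>n. a (n + N)) < e"
    using suminf_exist_split[OF e summ] unfolding a_def real_norm_def abs_less_iff by blast
  obtain h where h: "\<And>n. bij_betw (h n) {..<card (\<F> n)} (\<F> n)"
    using ex_bij_betw_nat_finite[OF fin] by (metis atLeast0LessThan)
  define U where "U = (\<lambda>(m, j). if j < card (\<F> (m + N)) then h (m + N) j else {})"
  have hF: "h n j \<in> \<F> n" if "j < card (\<F> n)" for n j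
    using h that by (auto simp: bij_betw_def)
  have row: "(\<Sum>j. ennreal (diameter (U (m, j)) powr s)) \<le> ennreal (a (m + N))" for m
  proof -
    have "(\<Sum>j. ennreal (diameter (U (m, j)) powr s)) =
        (\<Sum>j<card (\<F> (m + N)). ennreal (diameter (U (m, j)) powr s))"
      by (rule suminf_finite) (use s in \<open>auto simp: U_def\<close>)
    also have "\<dots> \<le> (\<Sum>j<card (\<F> (m + N)). ennreal (D (m + N) powr s))"
    proof (rule sum_mono, rule ennreal_leI, rule powr_mono2)
      fix j assume "j \<in> {..<card (\<F> (m + N))}"
      then have "U (m, j) \<in> \<F> (m + N)" by (auto simp: U_def hF)
      then show "0 \<le> diameter (U (m, j))" "diameter (U (m, j)) \<le> D (m + N)"
        using diam diameter_ge_0[OF bdd] by auto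
    qed (use s in auto)
    also have "\<dots> = ennreal (a (m + N))"
      by (simp add: a_def ennreal_of_nat_eq_real_of_nat ennreal_mult)
    finally show ?thesis .
  qed
  have "E \<subseteq> (\<Union>i. U (prod_decode i))"
  proof
    fix x assume "x \<in> E"
    then obtain n where n: "n \<ge> N" "x \<in> \<Union>(\<F> n)"
      using inf[of x] unfolding frequently_sequentially by blast
    then obtain B where "B \<in> \<F> n" "x \<in> B" by auto
    then obtain j where "j < card (\<F> n)" "x \<in> h n j"
      using h[of n] by (auto simp: bij_betw_def image_iff)
    then have "x \<in> U (prod_decode (prod_encode (n - N, j)))" using n by (simp add: U_def)
    then show "x \<in> (\<Union>i. U (prod_decode i))" by blast
  qed
  moreover have "bounded (U (prod_decode i))" for i
    by (cases "prod_decode i") (auto simp: U_def intro: bdd hF)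
  moreover have "(\<Sum>i. ennreal (diameter (U (prod_decode i)) powr s)) < ennreal e"
  proof -
    have "(\<Sum>i. ennreal (diameter (U (prod_decode i)) powr s)) =
        (\<Sum>m. \<Sum>j. ennreal (diameter (U (m, j)) powr s))"
      by (rule suminf_ennreal_2dimen) (rule refl)
    also have "\<dots> \<le> (\<Sum>m. ennreal (a (m + N)))"
      by (intro suminf_le row) auto
    also have "\<dots> = ennreal (\<Sum>m. a (m + N))"
      by (rule suminf_ennreal2) (use a0 summ in \<open>auto simp: a_def intro!: summable_ignore_initial_segment\<close>)
    also have "\<dots> < ennreal e" using N e by (simp add: ennreal_less_iff suminf_nonneg a0 ennreal_lessI)
    finally show ?thesis .
  qed
  ultimately show "\<exists>U. E \<subseteq> (\<Union>i. U i) \<and> (\<forall>i. bounded (U i)) \<and>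
      (\<Sum>i. ennreal (diameter (U i) powr s)) < ennreal e"
    by (intro exI[of _ "\<lambda>i. U (prod_decode i)"]) simp
qed

text \<open>
The mass distribution principle without a limit measure. A countable cover of the compact set
\<open>\<Inter>m. F m\<close> is thickened to open balls; finitely many of them already cover some \<open>F m\<close>, and then the uniform
distribution on the finite set \<open>C m\<close> bounds the sum over these balls from below.
\<close>
lemma mass_distribution:
  fixes F :: "nat \<Rightarrow> 'a :: heine_borel set" and C :: "nat \<Rightarrow> 'a set"
  assumes s: "0 < s" and K: "0 < K"
    and comp: "\<And>m. compact (F m)" and dec: "\<And>m. F (Suc m) \<subseteq> F m"
    and C: "\<And>m. finite (C m)" "\<And>m. C m \<noteq> {}" "\<And>m. C m \<subseteq> F m"
    and mass: "\<And>r. 0 < r \<Longrightarrow> \<forall>\<^sub>F m in sequentially. \<forall>x.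
       real (card (C m \<inter> ball x r)) \<le> K * r powr s * real (card (C m))"
  shows "hausdorff_measure s (\<Inter>m. F m) \<noteq> 0"
proof
  assume "hausdorff_measure s (\<Inter>m. F m) = 0"
  then obtain U :: "nat \<Rightarrow> 'a set" where U: "(\<Inter>m. F m) \<subseteq> (\<Union>i. U i)" "\<And>i. bounded (U i)"
      "(\<Sum>i. ennreal (diameter (U i) powr s)) < ennreal (1 / (2 * K))"
    using hausdorff_null_iff[OF s, of "\<Inter>m. F m"] K by (metis mult_pos_pos zero_less_divide_1_iff zero_less_numeral)
  define D where "D i = diameter (U i)" for i
  have D: "D i \<ge> 0" for i using diameter_ge_0[OF U(2)] by (simp add: D_def)
  \<comment> \<open>Radii slightly above the diameters; the excess is summable with total at most \<open>1 / (2 * K)\<close>.\<close>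
  have "\<exists>r>D i. r powr s < D i powr s + (1 / (4 * K)) * (1/2) ^ i" for i
  proof -
    have "((\<lambda>r. r powr s) \<longlongrightarrow> D i powr s) (at_right (D i))"
      using D[of i] s
      by (intro tendsto_powr' tendsto_intros) (auto simp: eventually_at_right_field intro!: exI[of _ 1])
    then have "\<forall>\<^sub>F r in at_right (D i). r powr s < D i powr s + (1 / (4 * K)) * (1/2) ^ i"
      by (rule order_tendstoD) (use K in auto)
    moreover have "\<forall>\<^sub>F r in at_right (D i). r > D i" by (rule eventually_at_right_less)
    ultimately have "\<forall>\<^sub>F r in at_right (D i). r > D i \<and> r powr s < D i powr s + (1 / (4 * K)) * (1/2) ^ i"
      by eventually_elim simp
    then show ?thesis using eventually_happens'[OF trivial_limit_at_right_real] by blast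
  qed
  then obtain r where r: "\<And>i. r i > D i" "\<And>i. r i powr s < D i powr s + (1 / (4 * K)) * (1/2) ^ i"
    by metis
  have r0: "r i > 0" for i using r(1)[of i] D[of i] by linarith
  define p where "p i = (SOME x. x \<in> U i)" for i
  have sub: "U i \<subseteq> ball (p i) (r i)" for i
  proof
    fix x assume x: "x \<in> U i"
    then have "p i \<in> U i" unfolding p_def by (rule someI)
    then have "dist (p i) x \<le> D i" using diameter_bounded_bound[OF U(2)] x by (simp add: D_def)
    then show "x \<in> ball (p i) (r i)" using r(1)[of i] by simp
  qed
  have decm: "F n \<subseteq> F m" if "m \<le> n" for m n
    using that dec by (meson lift_Suc_antimono_le)
  have "\<exists>m. F m \<subseteq> (\<Union>i. ball (p i) (r i))"
  proof (rule ccontr)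
    assume no: "\<nexists>m. F m \<subseteq> (\<Union>i. ball (p i) (r i))"
    define G where "G m = F m - (\<Union>i. ball (p i) (r i))" for m
    have "\<Inter>(range G) \<noteq> {}"
    proof (rule compact_nest)
      show "compact (G n)" for n
        unfolding G_def by (intro compact_diff comp open_UN) auto
      show "G n \<noteq> {}" for n using no by (auto simp: G_def)
      show "G n \<subseteq> G m" if "m \<le> n" for m n using decm[OF that] by (auto simp: G_def)
    qed
    then obtain x where "\<And>m. x \<in> G m" by blast
    then have "\<And>m. x \<in> F m" "\<And>i. x \<notin> ball (p i) (r i)" by (auto simp: G_def)
    then show False using U(1) sub by blast
  qed
  then obtain m0 where m0: "F m0 \<subseteq> (\<Union>i. ball (p i) (r i))" ..
  obtain I where I: "finite I" "F m0 \<subseteq> (\<Union>i\<in>I. ball (p i) (r i))"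
    using compactE_image[OF comp[of m0], of UNIV "\<lambda>i. ball (p i) (r i)"] m0 by auto
  have "\<forall>\<^sub>F m in sequentially. m \<ge> m0 \<and> (\<forall>i\<in>I. \<forall>x.
       real (card (C m \<inter> ball x (r i))) \<le> K * r i powr s * real (card (C m)))"
    using I(1) mass[OF r0] by (intro eventually_conj eventually_ge_at_top eventually_ball_finite) auto
  then obtain m where m: "m \<ge> m0" "\<And>i x. i \<in> I \<Longrightarrow>
      real (card (C m \<inter> ball x (r i))) \<le> K * r i powr s * real (card (C m))"
    by (auto simp: eventually_sequentially)
  have cpos: "real (card (C m)) > 0" using C by (simp add: card_gt_0_iff)
  have "C m \<subseteq> (\<Union>i\<in>I. C m \<inter> ball (p i) (r i))"
    using C(3)[of m] decm[OF m(1)] I(2) by fastforce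
  then have "card (C m) \<le> card (\<Union>i\<in>I. C m \<inter> ball (p i) (r i))"
    using I C by (intro card_mono) auto
  also have "\<dots> \<le> (\<Sum>i\<in>I. card (C m \<inter> ball (p i) (r i)))" by (rule card_UN_le[OF I(1)])
  finally have "real (card (C m)) \<le> (\<Sum>i\<in>I. real (card (C m \<inter> ball (p i) (r i))))"
    by (metis of_nat_le_iff of_nat_sum)
  also have "\<dots> \<le> (\<Sum>i\<in>I. K * r i powr s * real (card (C m)))" by (intro sum_mono m)
  also have "\<dots> = K * real (card (C m)) * (\<Sum>i\<in>I. r i powr s)" by (simp add: sum_distrib_left mult_ac)
  finally have one: "1 \<le> K * (\<Sum>i\<in>I. r i powr s)"
    using cpos by (simp add: mult_ac)
  have "(\<Sum>i\<in>I. D i powr s) < 1 / (2 * K)"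
  proof -
    have "ennreal (\<Sum>i\<in>I. D i powr s) = (\<Sum>i\<in>I. ennreal (D i powr s))" by simp
    also have "\<dots> \<le> (\<Sum>i. ennreal (D i powr s))" by (rule sum_le_suminf) (auto simp: I)
    also have "\<dots> < ennreal (1 / (2 * K))" using U(3) by (simp add: D_def)
    finally show ?thesis by (simp add: ennreal_less_iff sum_nonneg)
  qed
  moreover have "(\<Sum>i\<in>I. (1 / (4 * K)) * (1/2) ^ i) \<le> (1 / (4 * K)) * 2"
  proof -
    have "(\<Sum>i\<in>I. (1/2::real) ^ i) \<le> (\<Sum>i. (1/2) ^ i)"
      by (rule sum_le_suminf) (auto simp: I summable_geometric_iff)
    also have "\<dots> = 2" by (simp add: suminf_geometric)
    finally have "(1 / (4 * K)) * (\<Sum>i\<in>I. (1/2::real) ^ i) \<le> (1 / (4 * K)) * 2"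
      using K by (intro mult_left_mono) auto
    then show ?thesis by (simp only: sum_distrib_left)
  qed
  moreover have "(\<Sum>i\<in>I. r i powr s) \<le> (\<Sum>i\<in>I. D i powr s + (1 / (4 * K)) * (1/2) ^ i)"
    using r(2) by (intro sum_mono less_imp_le)
  ultimately have "(\<Sum>i\<in>I. r i powr s) < 1 / (2 * K) + (1 / (4 * K)) * 2"
    by (simp add: sum.distrib)
  also have "\<dots> = 1 / K" using K by (simp add: field_simps)
  finally show False using one K by (simp add: field_simps)
qed

section \<open>The exponent of one coordinate\<close>

text \<open>
Consider intervals of length \<open>exp (- l n - a n)\<close> that are spaced \<open>exp (- l n)\<close> apart. In the unit
interval, at scale \<open>exp (- u n)\<close>, about \<open>exp (u n)\<close> intervals cover them while \<open>u \<le> l\<close>, then one per piece, \<open>exp (l n)\<close> in total, and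
\<open>exp ((u - a) n)\<close> once the scale is below the length of a piece. The function is the resulting exponent.
\<close>
definition mass_exponent :: "real \<Rightarrow> real \<Rightarrow> real \<Rightarrow> real" where
  "mass_exponent a l u = max (min u l) (u - a)"

lemma mass_exponent_le: "0 \<le> a \<Longrightarrow> mass_exponent a l u \<le> u"
  by (simp add: mass_exponent_def)

text \<open>
The slope of the exponent drops from \<open>1\<close> to \<open>0\<close> at \<open>l\<close> and rises back to \<open>1\<close> only at \<open>l + a\<close>, so an interval
without \<open>l + a\<close> in its interior is an interval of concavity.
\<close>
lemma mass_exponent_concave:
  assumes a: "0 \<le> a" and out: "l + a \<le> p \<or> q \<le> l + a" and pq: "p \<le> q" and t: "0 \<le> t" "t \<le> 1"
  shows "(1 - t) * mass_exponent a l p + t * mass_exponent a l q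
    \<le> mass_exponent a l ((1 - t) * p + t * q)"
proof (cases "l + a \<le> p")
  case True
  have eq: "mass_exponent a l u = u - a" if "p \<le> u" for u
    using that True a by (auto simp: mass_exponent_def)
  have "p \<le> (1 - t) * p + t * q"
    using pq t mult_left_mono[OF pq t(1)] by (simp add: algebra_simps)
  then show ?thesis using pq by (simp add: eq algebra_simps)
next
  case False
  with out pq have q: "q \<le> l + a" by auto
  have eq: "mass_exponent a l u = min u l" if "u \<le> q" for u
    using that q a by (auto simp: mass_exponent_def)
  have "(1 - t) * p + t * q \<le> q"
    using pq t mult_left_mono[OF pq, of "1 - t"] by (simp add: algebra_simps)
  moreover have "(1 - t) * min p l \<le> (1 - t) * p" "(1 - t) * min p l \<le> (1 - t) * l"
    "t * min q l \<le> t * q" "t * min q l \<le> t * l"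
    using t by (auto intro!: mult_left_mono)
  ultimately show ?thesis using pq by (auto simp: eq algebra_simps)
qed

text \<open>
The breakpoints \<open>l j + a\<close> are the only convex kinks of the sum. Between two neighbouring ones, and
between \<open>0\<close> and the first, the sum is concave and lies above the line \<open>S * u\<close> because it does so at the end points;
after the last one its slope is \<open>CARD('i)\<close>, which is at least \<open>S\<close>.
\<close>
lemma mass_exponent_sum_ge:
  fixes l :: "'i :: finite \<Rightarrow> real"
  assumes a: "0 \<le> a" and l: "\<And>i. 0 < l i"
    and crit: "\<And>j. S * (l j + a) \<le> (\<Sum>i\<in>UNIV. mass_exponent a (l i) (l j + a))"
    and u: "0 \<le> u"
  shows "S * u \<le> (\<Sum>i\<in>UNIV. mass_exponent a (l i) u)"
proof -
  let ?G = "\<lambda>u. \<Sum>i\<in>UNIV. mass_exponent a (l i) u"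
  define B where "B = insert 0 (range (\<lambda>j. l j + a))"
  have B: "finite B" "0 \<in> B" by (auto simp: B_def)
  have G0: "mass_exponent a (l i) 0 = 0" for i
    using l[of i] a by (simp add: mass_exponent_def)
  have critB: "S * b \<le> ?G b" if "b \<in> B" for b
    using that crit by (auto simp: B_def G0)
  \<comment> \<open>\<open>p\<close> and \<open>q\<close> are the breakpoints next to \<open>u\<close>.\<close>
  define p where "p = Max {b \<in> B. b \<le> u}"
  have p: "p \<in> B" "p \<le> u" and pmax: "\<And>b. b \<in> B \<Longrightarrow> b \<le> u \<Longrightarrow> b \<le> p"
  proof -
    have "p \<in> {b \<in> B. b \<le> u}" unfolding p_def by (rule Max_in) (use B u in auto)
    then show "p \<in> B" "p \<le> u" by auto
  qed (use B in \<open>auto simp: p_def\<close>)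
  show ?thesis
  proof (cases "\<exists>b\<in>B. u \<le> b")
    case True
    define q where "q = Min {b \<in> B. u \<le> b}"
    have q: "q \<in> B" "u \<le> q" and qmin: "\<And>b. b \<in> B \<Longrightarrow> u \<le> b \<Longrightarrow> q \<le> b"
    proof -
      have "q \<in> {b \<in> B. u \<le> b}" unfolding q_def by (rule Min_in) (use B True in auto)
      then show "q \<in> B" "u \<le> q" by auto
    qed (use B in \<open>auto simp: q_def\<close>)
    obtain t where t: "0 \<le> t" "t \<le> 1" "u = (1 - t) * p + t * q"
    proof (cases "p = q")
      case True
      then show ?thesis using p q that[of 0] by simp
    next
      case False
      then have "p < q" using p q by simp
      define t where "t = (u - p) / (q - p)"
      have "t * (q - p) = u - p" "0 \<le> t" "t \<le> 1"
        using \<open>p < q\<close> p q by (simp_all add: t_def divide_le_eq)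
      then show ?thesis using that[of t] by (simp add: algebra_simps)
    qed
    have "S * u = (1 - t) * (S * p) + t * (S * q)" by (simp add: t algebra_simps)
    also have "\<dots> \<le> (1 - t) * ?G p + t * ?G q"
      using t critB[OF p(1)] critB[OF q(1)] by (intro add_mono mult_left_mono) auto
    also have "\<dots> = (\<Sum>i\<in>UNIV. (1 - t) * mass_exponent a (l i) p + t * mass_exponent a (l i) q)"
      by (simp add: sum.distrib sum_distrib_left)
    also have "\<dots> \<le> ?G u"
      unfolding t(3)
    proof (intro sum_mono mass_exponent_concave a t(1,2))
      show "p \<le> q" using p q by simp
      show "l i + a \<le> p \<or> q \<le> l i + a" for i
        using pmax[of "l i + a"] qmin[of "l i + a"] linear[of "l i + a" u] by (auto simp: B_def)
    qed
    finally show ?thesis .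
  next
    case False
    have big: "l i + a \<le> p" for i 
    proof -
      have "l i + a \<in> B" by (simp add: B_def)
      with False pmax show ?thesis by (meson linear)
    qed
    have eq: "mass_exponent a (l i) v = v - a" if "p \<le> v" for i v
      using big[of i] that a by (auto simp: mass_exponent_def)
    have "p > 0" using big[of undefined] l[of undefined] a by linarith
    moreover have "S * p \<le> real CARD('i) * p"
      using critB[OF p(1)] sum_bounded_above[of UNIV "\<lambda>i. mass_exponent a (l i) p" p]
        mass_exponent_le[OF a] by fastforce
    ultimately have "S \<le> real CARD('i)" by simp
    then have "S * (u - p) \<le> real CARD('i) * (u - p)" using p by (intro mult_right_mono) auto
    moreover have "S * p \<le> real CARD('i) * (p - a)" using critB[OF p(1)] by (simp add: eq)
    ultimately show ?thesis using p by (simp add: eq algebra_simps)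
  qed
qed

section \<open>Counting integers and boxes\<close>

lemma card_integers_interval_le:
  fixes x \<rho> Q :: real
  assumes "0 < Q" "0 \<le> \<rho>"
  shows "finite {z :: int. x \<le> z / Q \<and> z / Q \<le> x + \<rho>}"
    and "real (card {z :: int. x \<le> z / Q \<and> z / Q \<le> x + \<rho>}) \<le> \<rho> * Q + 1"
proof -
  have eq: "{z :: int. x \<le> z / Q \<and> z / Q \<le> x + \<rho>} = {\<lceil>x * Q\<rceil> .. \<lfloor>(x + \<rho>) * Q\<rfloor>}"
    using assms by (auto simp: ceiling_le_iff le_floor_iff pos_le_divide_eq pos_divide_le_eq)
  then show "finite {z :: int. x \<le> z / Q \<and> z / Q \<le> x + \<rho>}" by simp
  have "0 \<le> \<rho> * Q" using assms by simp
  then show "real (card {z :: int. x \<le> z / Q \<and> z / Q \<le> x + \<rho>}) \<le> \<rho> * Q + 1"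
    unfolding eq card_atLeastAtMost_int by (simp add: distrib_right) linarith
qed

lemma card_integers_near_le:
  fixes x \<rho> :: real
  assumes "0 \<le> \<rho>"
  shows "finite {z :: int. \<bar>z - x\<bar> \<le> \<rho>}" "real (card {z :: int. \<bar>z - x\<bar> \<le> \<rho>}) \<le> 2 * \<rho> + 1"
proof -
  have "{z :: int. \<bar>z - x\<bar> \<le> \<rho>} = {z :: int. x - \<rho> \<le> z / 1 \<and> z / 1 \<le> (x - \<rho>) + 2 * \<rho>}"
    by (auto simp: abs_le_iff)
  then show "finite {z :: int. \<bar>z - x\<bar> \<le> \<rho>}" "real (card {z :: int. \<bar>z - x\<bar> \<le> \<rho>}) \<le> 2 * \<rho> + 1"
    using card_integers_interval_le[of 1 "2 * \<rho>" "x - \<rho>"] assms by simp_all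
qed

lemma card_vec_box:
  fixes S :: "'n :: finite \<Rightarrow> 'a set"
  shows "card {y :: 'a ^ 'n. \<forall>i. y $ i \<in> S i} = (\<Prod>i\<in>UNIV. card (S i))"
    and "(\<And>i. finite (S i)) \<Longrightarrow> finite {y :: 'a ^ 'n. \<forall>i. y $ i \<in> S i}"
proof -
  have eq: "{y :: 'a ^ 'n. \<forall>i. y $ i \<in> S i} = vec_lambda ` (\<Pi>\<^sub>E i\<in>UNIV. S i)"
    by (auto simp: PiE_UNIV_domain image_iff Bex_def intro!: exI[of _ "vec_nth _"])
  have "inj_on vec_lambda (\<Pi>\<^sub>E i\<in>UNIV. S i)"
    by (auto simp: inj_on_def vec_lambda_inject)
  then show "card {y :: 'a ^ 'n. \<forall>i. y $ i \<in> S i} = (\<Prod>i\<in>UNIV. card (S i))"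
    unfolding eq by (simp add: card_image card_PiE)
  show "finite {y :: 'a ^ 'n. \<forall>i. y $ i \<in> S i}" if "\<And>i. finite (S i)"
    unfolding eq using that by (intro finite_imageI finite_PiE) auto
qed

lemma compact_vec_box:
  fixes S :: "'n :: finite \<Rightarrow> real set"
  assumes "\<And>i. compact (S i)"
  shows "compact {y :: real ^ 'n. \<forall>i. y $ i \<in> S i}"
proof -
  have "\<forall>i. \<exists>B. \<forall>x\<in>S i. \<bar>x\<bar> \<le> B"
    using assms by (metis compact_imp_bounded bounded_real)
  then obtain B where B: "\<And>i x. x \<in> S i \<Longrightarrow> \<bar>x\<bar> \<le> B i" by metis
  have "norm y \<le> (\<Sum>i\<in>UNIV. B i)" if "\<forall>i. y $ i \<in> S i" for y :: "real ^ 'n"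
    using norm_le_l1_cart[of y] sum_mono[of UNIV "\<lambda>i. \<bar>y $ i\<bar>" B] B that by fastforce
  then have "bounded {y :: real ^ 'n. \<forall>i. y $ i \<in> S i}" unfolding bounded_iff by blast
  then show ?thesis using assms by (simp add: compact_eq_bounded_closed closed_vector_box)
qed

lemma power_minus_1_bounds:
  fixes x :: int
  assumes "2 \<le> \<bar>x\<bar>" "1 \<le> n"
  defines "q \<equiv> \<bar>of_int x ^ n - 1 :: real\<bar>"
  shows "1 \<le> q" "exp (ln \<bar>of_int x\<bar> * n) / 2 \<le> q" "q \<le> 2 * exp (ln \<bar>of_int x\<bar> * n)"
proof -
  have x: "2 \<le> \<bar>of_int x :: real\<bar>" using assms(1) by linarith
  then have e: "exp (ln \<bar>of_int x :: real\<bar> * n) = \<bar>of_int x ^ n\<bar>"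
    by (simp add: power_abs mult.commute exp_of_nat_mult)
  have "2 ^ 1 \<le> \<bar>of_int x :: real\<bar> ^ n"
    using x assms(2) by (intro order_trans[OF power_increasing[of 1 n "2::real"] power_mono]) auto
  then have "2 \<le> \<bar>of_int x ^ n :: real\<bar>" by (simp add: power_abs)
  then show "1 \<le> q" "exp (ln \<bar>of_int x\<bar> * n) / 2 \<le> q" "q \<le> 2 * exp (ln \<bar>of_int x\<bar> * n)"
    unfolding e q_def by linarith+
qed

section \<open>Covering the nearly periodic points\<close>

text \<open>
One coordinate of the points that are recurrent at time \<open>n\<close>, restricted to \<open>[- M, M]\<close>.
\<close>
definition near_periodic :: "int \<Rightarrow> real \<Rightarrow> real \<Rightarrow> nat \<Rightarrow> real set" where
  "near_periodic b M \<eta> n = {y. \<bar>y\<bar> \<le> M \<and> (\<exists>z :: int. \<bar>(of_int b ^ n - 1) * y - z\<bar> \<le> \<eta>)}"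

text \<open>
The integer \<open>m\<close> stands for the interval \<open>[m * r, (m + 1) * r)\<close>.
\<close>
definition cells :: "real \<Rightarrow> real set \<Rightarrow> int set" where
  "cells r Y = (\<lambda>y. \<lfloor>y / r\<rfloor>) ` Y"

text \<open>
The trivial count of all cells of length \<open>r\<close> in \<open>[- M, M]\<close>, which is the better one when \<open>r\<close> exceeds the spacing
of the periodic points.
\<close>
lemma cells_bounded:
  assumes r: "0 < r" "r \<le> 1" and M: "0 \<le> M"
  shows "finite (cells r (near_periodic b M \<eta> n))"
    and "real (card (cells r (near_periodic b M \<eta> n))) \<le> (2 * M + 3) / r"
proof -
  have sub: "cells r (near_periodic b M \<eta> n) \<subseteq> {z :: int. \<bar>z - 0\<bar> \<le> M / r + 1}"
  proof
    fix m assume "m \<in> cells r (near_periodic b M \<eta> n)"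
    then obtain y where y: "m = \<lfloor>y / r\<rfloor>" "\<bar>y\<bar> \<le> M" by (auto simp: cells_def near_periodic_def)
    have "\<bar>y / r\<bar> \<le> M / r" using y r by (simp add: divide_right_mono)
    then have "\<bar>real_of_int \<lfloor>y / r\<rfloor>\<bar> \<le> M / r + 1" by linarith
    then show "m \<in> {z :: int. \<bar>z - 0\<bar> \<le> M / r + 1}" by (simp add: y(1))
  qed
  have pos: "0 \<le> M / r + 1" using r M by simp
  show "finite (cells r (near_periodic b M \<eta> n))"
    using finite_subset[OF sub card_integers_near_le(1)[OF pos]] .
  have "real (card (cells r (near_periodic b M \<eta> n))) \<le> real (card {z :: int. \<bar>z - 0\<bar> \<le> M / r + 1})"
    by (intro of_nat_mono card_mono card_integers_near_le(1)[OF pos] sub)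
  also have "\<dots> \<le> 2 * (M / r + 1) + 1" by (rule card_integers_near_le(2)[OF pos])
  also have "\<dots> \<le> (2 * M + 3) / r" using r by (simp add: field_simps)
  finally show "real (card (cells r (near_periodic b M \<eta> n))) \<le> (2 * M + 3) / r" .
qed

text \<open>
There are about \<open>2 * q * M\<close> periodic points in \<open>[- M, M]\<close>, and the neighbourhood of each of them,
of radius \<open>\<eta> / q\<close>, meets about \<open>2 * \<eta> / (q * r)\<close> cells.
\<close>
lemma cells_near_periodic:
  assumes r: "0 < r" and M: "0 \<le> M" and \<eta>: "0 \<le> \<eta>"
    and q: "q = \<bar>of_int b ^ n - 1 :: real\<bar>" "0 < q"
  shows "real (card (cells r (near_periodic b M \<eta> n))) \<le> (2 * (q * M + \<eta>) + 1) * (2 * (\<eta> / (q * r)) + 3)"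
proof -
  let ?p = "of_int b ^ n - 1 :: real"
  define Z where "Z = {z :: int. \<bar>z - 0\<bar> \<le> q * M + \<eta>}"
  define W where "W z = {m :: int. \<bar>m - z / (?p * r)\<bar> \<le> \<eta> / (q * r) + 1}" for z :: int
  have pos: "0 \<le> q * M + \<eta>" "0 \<le> \<eta> / (q * r) + 1" using assms by auto
  have Z: "finite Z" "real (card Z) \<le> 2 * (q * M + \<eta>) + 1"
    unfolding Z_def by (rule card_integers_near_le[OF pos(1)])+
  have W: "finite (W z)" "real (card (W z)) \<le> 2 * (\<eta> / (q * r)) + 3" for z
    using card_integers_near_le[OF pos(2), of "z / (?p * r)"] unfolding W_def by auto
  have "cells r (near_periodic b M \<eta> n) \<subseteq> (\<Union>z\<in>Z. W z)"
  proof
    fix m assume "m \<in> cells r (near_periodic b M \<eta> n)"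
    then obtain y z where y: "m = \<lfloor>y / r\<rfloor>" "\<bar>y\<bar> \<le> M" "\<bar>?p * y - of_int z\<bar> \<le> \<eta>"
      by (auto simp: cells_def near_periodic_def)
    have "\<bar>?p * y\<bar> \<le> q * M" unfolding abs_mult q(1)[symmetric] using y(2) q(2) by (intro mult_left_mono) auto
    then have "z \<in> Z" using y(3) by (simp add: Z_def)
    moreover have "m \<in> W z"
    proof -
      have p: "?p \<noteq> 0" using q by auto
      have "y / r - z / (?p * r) = (?p * y - z) / (?p * r)" using p r by (simp add: field_simps)
      then have "\<bar>y / r - z / (?p * r)\<bar> = \<bar>?p * y - z\<bar> / (q * r)" using q(1) r by (simp add: abs_mult)
      also have "\<dots> \<le> \<eta> / (q * r)" using y(3) q(2) r by (intro divide_right_mono) auto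
      finally have "\<bar>real_of_int \<lfloor>y / r\<rfloor> - z / (?p * r)\<bar> \<le> \<eta> / (q * r) + 1" by linarith
      then show ?thesis by (simp add: W_def y(1))
    qed
    ultimately show "m \<in> (\<Union>z\<in>Z. W z)" by blast
  qed
  then have "card (cells r (near_periodic b M \<eta> n)) \<le> card (\<Union>z\<in>Z. W z)"
    using Z(1) W(1) by (intro card_mono) auto
  also have "\<dots> \<le> (\<Sum>z\<in>Z. card (W z))" by (rule card_UN_le[OF Z(1)])
  finally have "real (card (cells r (near_periodic b M \<eta> n))) \<le> real (\<Sum>z\<in>Z. card (W z))" by (rule of_nat_mono)
  also have "\<dots> = (\<Sum>z\<in>Z. real (card (W z)))" by (rule of_nat_sum)
  also have "\<dots> \<le> real (card Z) * (2 * (\<eta> / (q * r)) + 3)"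
    using sum_bounded_above[of Z "\<lambda>z. real (card (W z))" "2 * (\<eta> / (q * r)) + 3"] W(2) by simp
  also have "\<dots> \<le> (2 * (q * M + \<eta>) + 1) * (2 * (\<eta> / (q * r)) + 3)"
    using Z(2) \<eta> q(2) r by (intro mult_right_mono) auto
  finally show ?thesis .
qed

text \<open>
With cells of length \<open>exp (- (v + t) * n)\<close> the two counts are \<open>exp (n * (v + t))\<close> and \<open>exp (n * max l v)\<close>, up to
constants, and the exponent of the smaller one is \<open>mass_exponent t l (v + t)\<close>.
\<close>
lemma cells_exponent:
  fixes b :: int and t M C v :: real
  defines "l \<equiv> ln \<bar>real_of_int b\<bar>"
  assumes b: "2 \<le> \<bar>b\<bar>" and t: "0 \<le> t" and M: "0 \<le> M" and C: "0 \<le> C" and v: "0 \<le> v"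
  obtains K where "0 < K" "\<And>n. 1 \<le> n \<Longrightarrow>
    real (card (cells (exp (- (v + t) * n)) (near_periodic b M (C * exp (- t * n)) n)))
      \<le> K * exp (n * mass_exponent t l (v + t))"
proof -
  have l: "0 < l"
  proof -
    have "1 < \<bar>real_of_int b\<bar>" using b by linarith
    then show ?thesis by (simp add: l_def)
  qed
  define K where "K = (2 * M + 3) + (4 * M + 2 * C + 1) * (4 * C + 3)"
  have prod0: "0 \<le> (4 * M + 2 * C + 1) * (4 * C + 3)" using M C by (intro mult_nonneg_nonneg) auto
  then have K: "0 < K" "2 * M + 3 \<le> K" "(4 * M + 2 * C + 1) * (4 * C + 3) \<le> K"
    using M by (auto simp: K_def)
  have "real (card (cells (exp (- (v + t) * n)) (near_periodic b M (C * exp (- t * n)) n)))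
      \<le> K * exp (n * mass_exponent t l (v + t))" (is "?N \<le> _") if n: "1 \<le> n" for n :: nat
  proof -
    define r where "r = exp (- (v + t) * n)"
    define q where "q = \<bar>of_int b ^ n - 1 :: real\<bar>"
    define e where "e = exp (l * n)"
    have r: "0 < r" "r \<le> 1" using v t by (simp_all add: r_def mult_nonpos_nonneg)
    have q: "1 \<le> q" "e / 2 \<le> q" "q \<le> 2 * e"
      using power_minus_1_bounds[OF b n] by (simp_all add: q_def l_def e_def)
    have e1: "1 \<le> e" using l by (simp add: e_def)
    have "?N \<le> (2 * M + 3) / r" unfolding r_def[symmetric] by (rule cells_bounded(2)[OF r M])
    also have "\<dots> = (2 * M + 3) * exp (n * (v + t))" 
    proof -
      have "inverse r = exp (n * (v + t))" unfolding r_def exp_minus[symmetric] by (simp add: algebra_simps)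
      then show ?thesis by (simp only: divide_inverse)
    qed
    also have "\<dots> \<le> K * exp (n * (v + t))" using K(2) by (intro mult_right_mono) auto
    finally have N1: "?N \<le> K * exp (n * (v + t))" .
    have \<eta>: "C * exp (- t * n) \<le> C" using t C by (simp add: mult_left_le)
    have "?N \<le> (2 * (q * M + C * exp (- t * n)) + 1) * (2 * (C * exp (- t * n) / (q * r)) + 3)"
      unfolding r_def[symmetric] by (rule cells_near_periodic) (use r M C q(1) in \<open>auto simp: q_def\<close>)
    also have "\<dots> \<le> ((4 * M + 2 * C + 1) * e) * ((4 * C + 3) * exp (n * max 0 (v - l)))"
    proof (intro mult_mono)
      have "q * M \<le> 2 * e * M" using q(3) M by (intro mult_right_mono)
      moreover have "C \<le> C * e" using C e1 by (simp add: mult_le_cancel_left1)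
      ultimately show "2 * (q * M + C * exp (- t * n)) + 1 \<le> (4 * M + 2 * C + 1) * e"
        using \<eta> e1 by (simp add: distrib_right mult.assoc mult.commute[of e M])
      have "exp (- t * n) / (q * r) \<le> exp (- t * n) / (e / 2 * r)"
        using q r e1 by (intro divide_left_mono mult_right_mono mult_pos_pos) auto
      also have "\<dots> = 2 * exp (n * (v - l))"
        by (simp add: e_def r_def algebra_simps exp_diff exp_minus exp_add)
      also have "\<dots> \<le> 2 * exp (n * max 0 (v - l))" by (simp add: mult_left_mono)
      finally have "C * (exp (- t * n) / (q * r)) \<le> C * (2 * exp (n * max 0 (v - l)))"
        using C by (intro mult_left_mono) auto
      moreover have "1 \<le> exp (n * max 0 (v - l))" by simp
      moreover have "2 * (C * exp (- t * n) / (q * r)) = 2 * (C * (exp (- t * n) / (q * r)))" by simp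
      moreover have "(4 * C + 3) * exp (n * max 0 (v - l))
          = 2 * (C * (2 * exp (n * max 0 (v - l)))) + 3 * exp (n * max 0 (v - l))"
        by (simp add: distrib_right)
      ultimately show "2 * (C * exp (- t * n) / (q * r)) + 3 \<le> (4 * C + 3) * exp (n * max 0 (v - l))"
        by linarith
    qed (use C q(1) r M e1 in auto)
    also have "\<dots> = (4 * M + 2 * C + 1) * (4 * C + 3) * (e * exp (n * max 0 (v - l)))" by simp
    also have "e * exp (n * max 0 (v - l)) = exp (n * max l v)"
      by (auto simp: e_def max_def algebra_simps simp flip: exp_add)
    also have "(4 * M + 2 * C + 1) * (4 * C + 3) * exp (n * max l v) \<le> K * exp (n * max l v)"
      using K(3) by (intro mult_right_mono) auto
    finally have N2: "?N \<le> K * exp (n * max l v)" .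
    have "mass_exponent t l (v + t) = min (v + t) (max l v)" using t by (auto simp: mass_exponent_def)
    then show ?thesis using N1 N2 by (auto simp: min_def)
  qed
  with K(1) show thesis by (rule that)
qed

text \<open>
Covering the \<open>n\<close>-th set by cubes of side \<open>exp (- (l j + t) * n)\<close> turns the Borel--Cantelli sum into a geometric
series whose ratio is below \<open>1\<close> by the hypothesis \<open>crit\<close>.
\<close>
lemma recurrent_points_null:
  fixes \<mu> :: "'n :: finite \<Rightarrow> int" and t s M C :: real
  defines "l \<equiv> \<lambda>i. ln \<bar>real_of_int (\<mu> i)\<bar>"
  assumes \<mu>: "\<And>i. 2 \<le> \<bar>\<mu> i\<bar>" and t: "0 \<le> t" and M: "0 \<le> M" and C: "0 \<le> C" and s: "0 < s"
    and crit: "(\<Sum>i\<in>UNIV. mass_exponent t (l i) (l j + t)) < s * (l j + t)"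
  shows "hausdorff_measure s {y :: real ^ 'n. \<exists>\<^sub>F n in sequentially.
    \<forall>i. y $ i \<in> near_periodic (\<mu> i) M (C * exp (- t * n)) n} = 0" (is "hausdorff_measure s ?E = 0")
proof -
  have lj: "0 < l j"
  proof -
    have "1 < \<bar>real_of_int (\<mu> j)\<bar>" using \<mu>[of j] by linarith
    then show ?thesis by (simp add: l_def)
  qed
  let ?G = "\<Sum>i\<in>UNIV. mass_exponent t (l i) (l j + t)"
  let ?d = "real CARD('n)"
  define r where "r n = exp (- (l j + t) * real n)" for n :: nat
  define I where "I n i = cells (r n) (near_periodic (\<mu> i) M (C * exp (- t * n)) n)" for n i
  \<comment> \<open>Half-open grid cubes, described by the integer parts of the scaled coordinates.\<close>
  define cube where "cube n m = {y :: real ^ 'n. \<forall>i. m $ i = \<lfloor>y $ i / r n\<rfloor>}" for n and m :: "int ^ 'n"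
  define \<F> where "\<F> n = cube n ` {m. \<forall>i. m $ i \<in> I n i}" for n
  have r: "0 < r n" "r n \<le> 1" for n using lj t by (simp_all add: r_def mult_nonpos_nonneg)
  have finI: "finite (I n i)" for n i unfolding I_def by (rule cells_bounded(1)[OF r M])
  have "\<exists>K. \<forall>i. 0 < K i \<and> (\<forall>n\<ge>1. real (card (I n i)) \<le> K i * exp (n * mass_exponent t (l i) (l j + t)))"
  proof (rule choice, rule allI)
    fix i
    from cells_exponent[OF \<mu>[of i] t M C less_imp_le[OF lj]] obtain K where "0 < K"
      "\<And>n. 1 \<le> n \<Longrightarrow> real (card (cells (exp (- (l j + t) * n)) (near_periodic (\<mu> i) M (C * exp (- t * n)) n)))
        \<le> K * exp (n * mass_exponent t (l i) (l j + t))" unfolding l_def by blast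
    then show "\<exists>K. 0 < K \<and> (\<forall>n\<ge>1. real (card (I n i)) \<le> K * exp (n * mass_exponent t (l i) (l j + t)))"
      unfolding I_def r_def by blast
  qed
  then obtain K where K: "\<And>i. 0 < K i"
    "\<And>n i. 1 \<le> n \<Longrightarrow> real (card (I n i)) \<le> K i * exp (n * mass_exponent t (l i) (l j + t))" by blast
  have card\<F>: "real (card (\<F> n)) \<le> (\<Prod>i\<in>UNIV. K i) * exp (n * ?G)" if n: "1 \<le> n" for n
  proof -
    have "card (\<F> n) \<le> card {m :: int ^ 'n. \<forall>i. m $ i \<in> I n i}"
      unfolding \<F>_def by (intro card_image_le card_vec_box(2) finI)
    then have "real (card (\<F> n)) \<le> real (\<Prod>i\<in>UNIV. card (I n i))" unfolding card_vec_box(1) by (rule of_nat_mono)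
    also have "\<dots> = (\<Prod>i\<in>UNIV. real (card (I n i)))" by (rule of_nat_prod)
    also have "\<dots> \<le> (\<Prod>i\<in>UNIV. K i * exp (n * mass_exponent t (l i) (l j + t)))"
      by (intro prod_mono conjI K(2) n of_nat_0_le_iff)
    also have "\<dots> = (\<Prod>i\<in>UNIV. K i) * exp (n * ?G)"
      by (simp add: prod.distrib sum_distrib_left exp_sum)
    finally show ?thesis .
  qed
  have cube: "norm (y - y') \<le> ?d * r n" if "y \<in> cube n m" "y' \<in> cube n m" for y y' n m
  proof -
    have "\<bar>(y - y') $ i\<bar> \<le> r n" for i
    proof -
      have "\<lfloor>y $ i / r n\<rfloor> = \<lfloor>y' $ i / r n\<rfloor>" using that unfolding cube_def mem_Collect_eq by metis
      then have "\<bar>y $ i / r n - y' $ i / r n\<bar> \<le> 1" by linarith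
      then have "\<bar>(y $ i - y' $ i) / r n\<bar> \<le> 1" by (simp add: diff_divide_distrib)
      then show ?thesis using r(1)[of n] by (simp add: abs_divide)
    qed
    then have "(\<Sum>i\<in>UNIV. \<bar>(y - y') $ i\<bar>) \<le> ?d * r n"
      using sum_bounded_above[of UNIV "\<lambda>i. \<bar>(y - y') $ i\<bar>" "r n"] by simp
    then show ?thesis using norm_le_l1_cart order_trans by blast
  qed
  show ?thesis
  proof (rule hausdorff_cantelli[where \<F> = \<F> and D = "\<lambda>n. ?d * r n"])
    show "finite (\<F> n)" for n unfolding \<F>_def by (intro finite_imageI card_vec_box(2) finI)
    show "bounded B" if "B \<in> \<F> n" for n B
      using that cube unfolding \<F>_def bounded_two_points dist_norm by blast
    show "diameter B \<le> ?d * r n" if "B \<in> \<F> n" for n B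
      by (rule diameter_leI) (use that cube r(1)[of n] in \<open>auto simp: \<F>_def dist_norm\<close>)
    show "\<exists>\<^sub>F n in sequentially. y \<in> \<Union> (\<F> n)" if "y \<in> ?E" for y
    proof -
      have "y \<in> \<Union> (\<F> n)" if "\<forall>i. y $ i \<in> near_periodic (\<mu> i) M (C * exp (- t * n)) n" for n
      proof -
        have "y \<in> cube n (\<chi> i. \<lfloor>y $ i / r n\<rfloor>)" by (simp add: cube_def)
        moreover have "\<lfloor>y $ i / r n\<rfloor> \<in> I n i" for i using that by (auto simp: I_def cells_def)
        ultimately show ?thesis unfolding \<F>_def by force
      qed
      then show ?thesis using \<open>y \<in> ?E\<close> by (auto elim: frequently_elim1)
    qed
    show "summable (\<lambda>n. real (card (\<F> n)) * (?d * r n) powr s)"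
    proof (rule summable_comparison_test')
      let ?x = "exp (?G - s * (l j + t))"
      show "summable (\<lambda>n. (\<Prod>i\<in>UNIV. K i) * ?d powr s * ?x ^ n)"
        using crit by (intro summable_mult summable_geometric) simp
      fix n :: nat assume n: "1 \<le> n"
      have "(?d * r n) powr s = ?d powr s * exp (- (s * (l j + t) * n))"
      proof -
        have "r n powr s = exp (- (s * (l j + t) * n))" by (simp add: r_def powr_def algebra_simps)
        then show ?thesis using r(1)[of n] by (simp add: powr_mult)
      qed
      then have "real (card (\<F> n)) * (?d * r n) powr s
          \<le> ((\<Prod>i\<in>UNIV. K i) * exp (n * ?G)) * (?d powr s * exp (- (s * (l j + t) * n)))"
        using card\<F>[OF n] by (simp add: mult_right_mono)
      also have "\<dots> = (\<Prod>i\<in>UNIV. K i) * ?d powr s * (exp (n * ?G) * exp (- (s * (l j + t) * n)))"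
        by (simp add: mult_ac)
      also have "exp (n * ?G) * exp (- (s * (l j + t) * n)) = ?x ^ n"
        by (simp add: right_diff_distrib mult_ac flip: exp_add exp_of_nat_mult)
      finally show "norm (real (card (\<F> n)) * (?d * r n) powr s) \<le> (\<Prod>i\<in>UNIV. K i) * ?d powr s * ?x ^ n"
        by simp
    qed
  qed (rule s)
qed

section \<open>Counting centres of a Cantor set on the line\<close>

text \<open>
The intervals of level \<open>k\<close> have length \<open>\<delta> k / q k\<close> and start at multiples of \<open>1 / q k\<close>. The last
assumption says that an interval of level \<open>k\<close> spans at least four gaps of length \<open>1 / q (k + 1)\<close>, which leaves room
for children even after discarding the points near its right end.
\<close>
locale cantor_scheme =
  fixes q \<delta> :: "nat \<Rightarrow> real"
  assumes q_pos: "0 < q k" and \<delta>_pos: "0 < \<delta> k" and \<delta>_less: "\<delta> k < 1"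
    and growth: "4 \<le> \<delta> k * q (Suc k) / q k"
begin

text \<open>
All intervals of level \<open>k\<close> get the same number of children, so that counting centres is exact. The
subtracted \<open>1\<close> keeps the whole child interval inside its parent.
\<close>
definition branching :: "nat \<Rightarrow> nat" where
  "branching k = nat (\<lfloor>\<delta> k * q (Suc k) / q k\<rfloor> - 1)"

definition kids :: "nat \<Rightarrow> int \<Rightarrow> int set" where
  "kids k z = {\<lceil>z * q (Suc k) / q k\<rceil> ..< \<lceil>z * q (Suc k) / q k\<rceil> + int (branching k)}"

fun descend :: "nat \<Rightarrow> nat \<Rightarrow> int set \<Rightarrow> int set" where
  "descend k 0 S = S"
| "descend k (Suc n) S = (\<Union>y\<in>descend k n S. kids (k + n) y)"

text \<open>
The integer \<open>z\<close> stands for the point \<open>z / q k\<close>, the left end of an interval of level \<open>k\<close>.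
\<close>
definition centres :: "nat \<Rightarrow> int set" where
  "centres k = descend 0 k {0}"

definition level :: "nat \<Rightarrow> real set" where
  "level k = (\<Union>z\<in>centres k. {z / q k .. (z + \<delta> k) / q k})"

lemma branching_le: "real (branching k) \<le> \<delta> k * q (Suc k) / q k - 1"
proof -
  define x where "x = \<delta> k * q (Suc k) / q k"
  have "4 \<le> x" using growth by (simp add: x_def)
  then show ?thesis unfolding branching_def x_def[symmetric] by linarith
qed

lemma branching_ge: "\<delta> k * q (Suc k) / q k / 2 \<le> real (branching k)"
proof -
  define x where "x = \<delta> k * q (Suc k) / q k"
  have "4 \<le> x" using growth by (simp add: x_def)
  then show ?thesis unfolding branching_def x_def[symmetric] by linarith
qed

lemma branching_pos: "0 < branching k"
  using branching_ge[of k] growth[of k] by (cases "branching k") auto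

text \<open>
The second inequality has \<open>y + 1\<close> in place of \<open>y + \<delta> (k + 1)\<close>: the full gap after a child still lies in its parent,
which makes the children of different parents disjoint.
\<close>
lemma kids_bounds:
  assumes "y \<in> kids k z"
  shows "z / q k \<le> y / q (Suc k)" "(real_of_int y + 1) / q (Suc k) \<le> (z + \<delta> k) / q k"
proof -
  let ?x = "z * q (Suc k) / q k"
  have "?x \<le> y" using assms by (simp add: kids_def ceiling_le_iff)
  then show "z / q k \<le> y / q (Suc k)"
    using q_pos[of k] q_pos[of "Suc k"] by (simp add: field_simps)
  have "real_of_int y + 1 \<le> ?x + \<delta> k * q (Suc k) / q k"
    using assms branching_le[of k] of_int_ceiling_le_add_one[of ?x] unfolding kids_def atLeastLessThan_iff
    by linarith
  then show "(real_of_int y + 1) / q (Suc k) \<le> (z + \<delta> k) / q k"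
    using q_pos[of k] q_pos[of "Suc k"] by (simp add: field_simps)
qed

lemma kids_disjoint:
  assumes "z \<noteq> z'"
  shows "kids k z \<inter> kids k z' = {}"
proof -
  have "kids k z \<inter> kids k z' = {}" if "z < z'" for z z'
  proof (rule ccontr)
    assume "kids k z \<inter> kids k z' \<noteq> {}"
    then obtain y where y: "y \<in> kids k z" "y \<in> kids k z'" by blast
    have "z' / q k \<le> y / q (Suc k)" by (rule kids_bounds[OF y(2)])
    also have "\<dots> \<le> (real_of_int y + 1) / q (Suc k)" using q_pos[of "Suc k"] by (simp add: divide_right_mono)
    also have "\<dots> \<le> (z + \<delta> k) / q k" by (rule kids_bounds[OF y(1)])
    finally have "z' \<le> z + \<delta> k" using q_pos[of k] by (simp add: divide_le_cancel)
    then show False using \<delta>_less[of k] that by linarith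
  qed
  then show ?thesis using assms by (metis inf_commute linorder_neq_iff)
qed

lemma card_kids: "finite (kids k z)" "card (kids k z) = branching k"
  by (simp_all add: kids_def)

lemma descend_finite: "finite S \<Longrightarrow> finite (descend k n S)"
  by (induction n) (simp_all add: card_kids)

lemma card_descend: "finite S \<Longrightarrow> card (descend k n S) = card S * (\<Prod>j<n. branching (k + j))"
proof (induction n)
  case (Suc n)
  have "card (descend k (Suc n) S) = (\<Sum>y\<in>descend k n S. card (kids (k + n) y))"
    unfolding descend.simps using Suc.prems
    by (intro card_UN_disjoint) (auto simp: card_kids descend_finite dest: kids_disjoint[where k = "k + n"])
  with Suc show ?case by (simp add: card_kids)
qed simp

lemma descend_ancestor:
  assumes "y \<in> descend k n S"
  shows "\<exists>z\<in>S. y \<in> descend k n {z} \<and> z / q k \<le> y / q (k + n) \<and> (real_of_int y + 1) / q (k + n) \<le> (real_of_int z + 1) / q k"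
  using assms
proof (induction n arbitrary: y)
  case (Suc n)
  then obtain x where x: "x \<in> descend k n S" "y \<in> kids (k + n) x" by auto
  with Suc.IH obtain z where z: "z \<in> S" "x \<in> descend k n {z}"
    "z / q k \<le> x / q (k + n)" "(real_of_int x + 1) / q (k + n) \<le> (real_of_int z + 1) / q k" by blast
  have "(x + \<delta> (k + n)) / q (k + n) \<le> (real_of_int x + 1) / q (k + n)"
    using q_pos[of "k + n"] \<delta>_less[of "k + n"] by (simp add: divide_right_mono)
  with kids_bounds[OF x(2)] z x show ?case by (intro bexI[of _ z]) auto
qed simp

lemma descend_add: "descend 0 (k + n) S = descend k n (descend 0 k S)"
  by (induction n) simp_all

lemma descend_mono: "S \<subseteq> T \<Longrightarrow> descend k n S \<subseteq> descend k n T"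
  by (induction n) (simp, fastforce)

lemma finite_centres: "finite (centres k)"
  by (simp add: centres_def descend_finite)

lemma card_centres: "card (centres k) = (\<Prod>j<k. branching j)"
  by (simp add: centres_def card_descend)

lemma card_centres_pos: "0 < card (centres k)"
  using branching_pos by (simp add: card_centres prod_pos)

text \<open>
Each step loses only the factor \<open>\<delta> j / 2\<close> against the number \<open>q (j + 1) / q j\<close> of all available points.
\<close>
lemma card_centres_ge: "q k / q 0 * (\<Prod>j<k. \<delta> j / 2) \<le> real (card (centres k))"
proof (induction k)
  case 0
  show ?case using q_pos[of 0] by (simp add: centres_def)
next
  case (Suc k)
  have "q (Suc k) / q 0 * (\<Prod>j<Suc k. \<delta> j / 2) =
      (q k / q 0 * (\<Prod>j<k. \<delta> j / 2)) * (\<delta> k * q (Suc k) / q k / 2)"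
    using q_pos[of k] by simp
  also have "\<dots> \<le> real (card (centres k)) * real (branching k)"
    using Suc branching_ge[of k] q_pos \<delta>_pos by (intro mult_mono) (auto intro: less_imp_le)
  finally show ?case by (simp add: card_centres)
qed

text \<open>
Passing from level \<open>m\<close> to the ancestors of level \<open>k\<close> costs nothing, since all of them have equally
many descendants. The ancestors are multiples of \<open>1 / q k\<close> in an interval of length \<open>\<rho> + 1 / q k\<close>, so there are at most
\<open>\<rho> * q k + 2\<close> of them. Every \<open>k \<le> m\<close> gives such a bound; which one is best depends on \<open>\<rho>\<close>.
\<close>
lemma centres_interval_fraction:
  assumes "k \<le> m" and \<rho>: "0 \<le> \<rho>"
  shows "real (card {z \<in> centres m. x \<le> z / q m \<and> z / q m \<le> x + \<rho>})
    \<le> (\<rho> + 2 / q k) * q 0 * (\<Prod>j<k. 2 / \<delta> j) * real (card (centres m))"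
proof -
  obtain n where m: "m = k + n" using assms(1) le_Suc_ex by blast
  \<comment> \<open>The ancestor of a point of \<open>[x, x + \<rho>]\<close> lies at most \<open>1 / q k\<close> to the left of it.\<close>
  define Z where "Z = {z :: int. x - 1 / q k \<le> z / q k \<and> z / q k \<le> x - 1 / q k + (\<rho> + 1 / q k)}"
  have Z: "finite Z" "real (card Z) \<le> \<rho> * q k + 2"
    using card_integers_interval_le[of "q k" "\<rho> + 1 / q k" "x - 1 / q k"] q_pos[of k] \<rho>
    by (auto simp: Z_def distrib_right)
  have "{z \<in> centres m. x \<le> z / q m \<and> z / q m \<le> x + \<rho>} \<subseteq> descend k n Z"
  proof
    fix y assume "y \<in> {z \<in> centres m. x \<le> z / q m \<and> z / q m \<le> x + \<rho>}"
    then have y: "y \<in> descend k n (centres k)" "x \<le> y / q m" "y / q m \<le> x + \<rho>"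
      by (simp_all add: centres_def m descend_add)
    then obtain z where z: "y \<in> descend k n {z}" "z / q k \<le> y / q m" "(real_of_int y + 1) / q m \<le> (real_of_int z + 1) / q k"
      using descend_ancestor m by metis
    have "y / q m \<le> (real_of_int y + 1) / q m" using q_pos[of m] by (simp add: divide_right_mono)
    also have "\<dots> \<le> z / q k + 1 / q k" using z(3) by (simp only: add_divide_distrib)
    finally have "x \<le> z / q k + 1 / q k" using y by simp
    then have "z \<in> Z" using y z by (simp add: Z_def)
    then show "y \<in> descend k n Z" using z descend_mono[of "{z}" Z] by auto
  qed
  then have "card {z \<in> centres m. x \<le> z / q m \<and> z / q m \<le> x + \<rho>} \<le> card Z * (\<Prod>j<n. branching (k + j))"
    using card_mono[OF descend_finite[OF Z(1)]] by (simp add: card_descend Z(1))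
  then have "real (card {z \<in> centres m. x \<le> z / q m \<and> z / q m \<le> x + \<rho>})
      \<le> real (card Z * (\<Prod>j<n. branching (k + j)))"
    by (rule of_nat_mono)
  also have "\<dots> = real (card Z) * real (\<Prod>j<n. branching (k + j))" by (rule of_nat_mult)
  also have "\<dots> \<le> (\<rho> * q k + 2) * real (\<Prod>j<n. branching (k + j))"
    by (intro mult_right_mono Z(2) of_nat_0_le_iff)
  also have "\<dots> \<le> ((\<rho> + 2 / q k) * q 0 * (\<Prod>j<k. 2 / \<delta> j) * real (card (centres k))) *
      real (\<Prod>j<n. branching (k + j))"
  proof (intro mult_right_mono)
    have pos: "(\<Prod>j<k. 2 / \<delta> j) > 0" using \<delta>_pos by (intro prod_pos) auto
    have inv: "(\<Prod>j<k. 2 / \<delta> j) * (\<Prod>j<k. \<delta> j / 2) = 1"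
      using \<delta>_pos by (simp add: less_imp_neq[THEN not_sym] flip: prod.distrib)
    have "\<rho> * q k + 2 = (\<rho> + 2 / q k) * q 0 * ((\<Prod>j<k. 2 / \<delta> j) * (q k / q 0 * (\<Prod>j<k. \<delta> j / 2)))"
    proof -
      have eq: "(\<Prod>j<k. 2 / \<delta> j) * (q k / q 0 * (\<Prod>j<k. \<delta> j / 2)) = q k / q 0"
        using inv by (metis mult.left_commute mult.right_neutral)
      show ?thesis unfolding eq using q_pos[of k] q_pos[of 0] by (simp add: field_simps)
    qed
    also have "\<dots> \<le> (\<rho> + 2 / q k) * q 0 * ((\<Prod>j<k. 2 / \<delta> j) * real (card (centres k)))"
      using pos q_pos[of 0] q_pos[of k] \<rho> by (intro mult_left_mono card_centres_ge) auto
    finally show "\<rho> * q k + 2 \<le> (\<rho> + 2 / q k) * q 0 * (\<Prod>j<k. 2 / \<delta> j) * real (card (centres k))"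
      by (simp add: mult_ac)
  qed (rule of_nat_0_le_iff)
  also have "\<dots> = (\<rho> + 2 / q k) * q 0 * (\<Prod>j<k. 2 / \<delta> j) *
      real (card (centres k) * (\<Prod>j<n. branching (k + j)))"
    by (simp only: of_nat_mult mult.assoc)
  also have "card (centres k) * (\<Prod>j<n. branching (k + j)) = card (centres m)"
    unfolding centres_def m descend_add by (simp add: card_descend descend_finite)
  finally show ?thesis .
qed

lemma level_Suc_subset: "level (Suc k) \<subseteq> level k"
proof
  fix x assume "x \<in> level (Suc k)"
  then obtain y where y: "y \<in> centres (Suc k)" "y / q (Suc k) \<le> x" "x \<le> (y + \<delta> (Suc k)) / q (Suc k)"
    by (auto simp: level_def)
  then obtain z where z: "z \<in> centres k" "y \<in> kids k z" by (auto simp: centres_def)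
  have "(y + \<delta> (Suc k)) / q (Suc k) \<le> (real_of_int y + 1) / q (Suc k)"
    using \<delta>_less[of "Suc k"] q_pos[of "Suc k"] by (simp add: divide_right_mono)
  then have "z / q k \<le> x" "x \<le> (z + \<delta> k) / q k" using y kids_bounds[OF z(2)] by auto
  then show "x \<in> level k" using z(1) by (auto simp: level_def)
qed

lemma compact_level: "compact (level k)"
  unfolding level_def by (intro compact_UN finite_centres) auto

lemma level_0: "level 0 = {0 .. \<delta> 0 / q 0}"
  by (simp add: level_def centres_def)

lemma centre_in_level: "z \<in> centres k \<Longrightarrow> z / q k \<in> level k"
  using \<delta>_pos[of k] q_pos[of k] unfolding level_def
  by (intro UN_I[of z]) (auto intro!: divide_right_mono)

end

section \<open>A product Cantor set of recurrent points\<close>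

lemma lacunary_sequence:
  fixes Q :: "nat set"
  assumes "infinite Q" "1 \<le> R"
  obtains n :: "nat \<Rightarrow> nat" where "\<And>k. n k \<in> Q" "N \<le> n 0" "\<And>k. R * n k \<le> n (Suc k)" "\<And>k. n k < n (Suc k)"
proof -
  have ex: "\<exists>n\<in>Q. m \<le> n" for m using assms(1) by (meson infinite_nat_iff_unbounded_le)
  have "\<exists>f. \<forall>k. (f k \<in> Q \<and> N \<le> f k) \<and> R * f k \<le> f (Suc k) \<and> f k < f (Suc k)"
  proof (rule dependent_nat_choice)
    show "\<exists>x. x \<in> Q \<and> N \<le> x" using ex by blast
    show "\<exists>y. (y \<in> Q \<and> N \<le> y) \<and> R * x \<le> y \<and> x < y" for x
      using ex[of "R * x + Suc x + N"] by (metis add_leD1 add_leD2 Suc_le_eq)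
  qed
  then show thesis using that by blast
qed

text \<open>
The Cantor scheme of each coordinate \<open>i\<close> with the common times \<open>n k\<close>. The assumptions \<open>c_exp\<close> and \<open>gap\<close> give every interval
children at the next level. The assumption \<open>subexp\<close> makes all constants and factors that accumulate before level
\<open>k\<close> at most \<open>exp (\<epsilon> * n k)\<close>.
\<close>
locale recurrence_scheme =
  fixes \<mu> :: "'n :: finite \<Rightarrow> int" and a c \<epsilon> :: real and n :: "nat \<Rightarrow> nat"
  assumes \<mu>: "2 \<le> \<bar>\<mu> i\<bar>" and a: "0 < a" and c: "0 < c" "c < 1" and \<epsilon>: "0 < \<epsilon>"
    and n1: "1 \<le> n k" and n_mono: "strict_mono n" and c_exp: "16 / c \<le> exp (n k)"
    and gap: "(a + 1) * n k \<le> ln 2 * (real (n (Suc k)) - n k)"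
    and subexp: "(\<epsilon> + a + 1) * n k \<le> \<epsilon> * n (Suc k)"
begin

definition l :: "'n \<Rightarrow> real" where
  "l i = ln \<bar>of_int (\<mu> i)\<bar>"

text \<open>
The points \<open>z / q i k\<close> with integer \<open>z\<close> are the fixed points of \<open>y \<mapsto> (\<mu> i)\<^sup>n y\<close> modulo \<open>1\<close> for \<open>n = n k\<close>;
the absolute value makes the spacing positive for negative eigenvalues as well.
\<close>
definition q :: "'n \<Rightarrow> nat \<Rightarrow> real" where
  "q i k = \<bar>of_int (\<mu> i) ^ n k - 1\<bar>"

definition \<delta> :: "nat \<Rightarrow> real" where
  "\<delta> k = c * exp (- a * n k)"

lemma ln_2_le_l: "ln 2 \<le> l i"
proof -
  have "2 \<le> \<bar>real_of_int (\<mu> i)\<bar>" using \<mu>[of i] by linarith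
  then show ?thesis unfolding l_def by (subst ln_le_cancel_iff) auto
qed

lemma q_bounds: "1 \<le> q i k" "exp (l i * n k) / 2 \<le> q i k" "q i k \<le> 2 * exp (l i * n k)"
  using power_minus_1_bounds[OF \<mu> n1] by (simp_all add: q_def l_def)

lemma \<delta>_bounds: "0 < \<delta> k" "\<delta> k \<le> c" "\<delta> k < 1"
proof -
  have "exp (- a * n k) \<le> 1" using a by simp
  then show "\<delta> k \<le> c" using c by (simp add: \<delta>_def mult_left_le)
  then show "\<delta> k < 1" using c by simp
qed (simp add: \<delta>_def c)

lemma centre_growth: "4 \<le> \<delta> k * q i (Suc k) / q i k"
proof -
  have n: "real (n k) \<le> n (Suc k)" using strict_mono_less[OF n_mono, of k "Suc k"] by simp
  then have "ln 2 * (real (n (Suc k)) - n k) \<le> l i * (real (n (Suc k)) - n k)"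
    using ln_2_le_l by (intro mult_right_mono) auto
  with gap[of k] have "a * n k + n k \<le> l i * n (Suc k) - l i * n k"
    by (simp add: algebra_simps)
  then have "exp (a * n k) * exp (n k) \<le> exp (l i * n (Suc k)) / exp (l i * n k)"
    by (simp flip: exp_add exp_diff)
  moreover have "exp (a * n k) * (16 / c) \<le> exp (a * n k) * exp (n k)"
    using c_exp by (intro mult_left_mono) auto
  ultimately have "exp (a * n k) * (16 / c) \<le> exp (l i * n (Suc k)) / exp (l i * n k)" by simp
  then have "4 \<le> \<delta> k * (exp (l i * n (Suc k)) / 2) / (2 * exp (l i * n k))"
    using c by (simp add: \<delta>_def exp_minus field_simps)
  also have "\<dots> \<le> \<delta> k * q i (Suc k) / q i k"
    using q_bounds[of i k] q_bounds(1,2)[of i "Suc k"] \<delta>_bounds(1)[of k]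
    by (intro frac_le mult_left_mono mult_nonneg_nonneg) auto
  finally show ?thesis .
qed

sublocale cantor: cantor_scheme "q i" \<delta> for i
proof
  show "0 < q i k" for k using q_bounds(1)[of i k] by linarith
qed (rule \<delta>_bounds centre_growth)+

text \<open>
An upper bound for the reciprocal of the proportion of available centres that the first \<open>k\<close> selections keep; it does not depend on
the coordinate because the relative lengths \<open>\<delta> j\<close> do not.
\<close>
definition loss :: "nat \<Rightarrow> real" where
  "loss k = (\<Prod>j<k. 2 / \<delta> j)"

lemma loss_Suc: "loss (Suc k) = loss k * (2 / c * exp (a * n k))"
  using c by (simp add: loss_def \<delta>_def exp_minus field_simps)

lemma loss_pos: "0 < loss k"
  unfolding loss_def using \<delta>_bounds(1) by (intro prod_pos) auto

text \<open>
The factor gained at level \<open>k\<close> is at most \<open>exp ((a + 1) * n k)\<close>, and \<open>n (k + 1)\<close> is so much larger than \<open>n k\<close> that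
\<open>subexp\<close> absorbs it.
\<close>
lemma loss_le: "loss k \<le> exp (\<epsilon> * n k)"
proof (induction k)
  case 0
  show ?case using \<epsilon> by (simp add: loss_def)
next
  case (Suc k)
  have "2 / c \<le> 16 / c" using c by (intro divide_right_mono) auto
  then have "2 / c \<le> exp (n k)" using c_exp by (rule order_trans)
  then have "loss (Suc k) \<le> exp (\<epsilon> * n k) * (exp (n k) * exp (a * n k))"
    unfolding loss_Suc using Suc loss_pos[of k] c by (intro mult_mono mult_right_mono) auto
  also have "\<dots> = exp ((\<epsilon> + a + 1) * n k)" by (simp add: algebra_simps flip: exp_add)
  also have "\<dots> \<le> exp (\<epsilon> * n (Suc k))" using subexp[of k] by simp
  finally show ?case .
qed

text \<open>
A constant large enough for both estimates of \<open>centres_fraction\<close> and independent of the coordinate; the factor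
\<open>1 / c\<close> comes from \<open>\<delta> k\<close>.
\<close>
definition mass_const :: real where
  "mass_const = 24 * (1 + (\<Sum>i\<in>UNIV. q i 0)) / c"

lemma mass_const_bounds: "12 * q i 0 \<le> mass_const * c" "6 * q i 0 \<le> mass_const" "1 \<le> mass_const"
proof -
  have q: "0 \<le> q i 0" for i using q_bounds(1)[of i 0] by simp
  have le: "q i 0 \<le> (\<Sum>i\<in>UNIV. q i 0)" using q by (intro member_le_sum) auto
  have mass_const: "mass_const * c = 24 * (1 + (\<Sum>i\<in>UNIV. q i 0))" using c by (simp add: mass_const_def)
  then show "12 * q i 0 \<le> mass_const * c" using le q[of i] by simp
  have "0 \<le> mass_const" using c q by (simp add: mass_const_def sum_nonneg add_nonneg_nonneg)
  then have "mass_const * c \<le> mass_const" using c by (simp add: mult_left_le)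
  then show "6 * q i 0 \<le> mass_const" "1 \<le> mass_const" using mass_const le q[of i] by simp_all
qed

lemma inverse_q_le: "2 / q i k \<le> 4 * exp (- (l i * n k))"
  using q_bounds[of i k] by (simp add: exp_minus field_simps)

text \<open>
Counting by ancestors of level \<open>k\<close> gives the exponent \<open>min L (l i * n k)\<close>, and counting by ancestors of level
\<open>k + 1\<close> gives \<open>L - a * n k\<close>. The larger of the two is \<open>n k\<close> times the \<open>mass_exponent\<close> at \<open>L / n k\<close>.
\<close>
lemma centres_fraction:
  assumes k: "k < m" "ln 2 * n k \<le> L" "L \<le> ln 2 * n (Suc k)"
  shows "real (card {z \<in> cantor.centres i m. x \<le> z / q i m \<and> z / q i m \<le> x + 2 * exp (- L)})
    \<le> mass_const * exp (\<epsilon> * n k) * exp (- (n k * mass_exponent a (l i) (L / n k))) * real (card (cantor.centres i m))"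
    (is "?N \<le> _ * real ?C")
proof -
  have "?N \<le> (2 * exp (- L) + 2 / q i k) * q i 0 * loss k * real ?C"
    unfolding loss_def by (rule cantor.centres_interval_fraction) (use k in auto)
  also have "\<dots> \<le> (6 * exp (- min L (l i * n k))) * q i 0 * exp (\<epsilon> * n k) * real ?C"
  proof (intro mult_mono loss_le order_refl)
    have "exp (- L) \<le> exp (- min L (l i * n k))" "exp (- (l i * n k)) \<le> exp (- min L (l i * n k))" by auto
    with inverse_q_le[of i k] show "2 * exp (- L) + 2 / q i k \<le> 6 * exp (- min L (l i * n k))" by linarith
  qed (use q_bounds(1)[of i 0] loss_pos[of k] in auto)
  also have "\<dots> = (6 * q i 0) * exp (\<epsilon> * n k) * exp (- min L (l i * n k)) * real ?C" by simp
  also have "\<dots> \<le> mass_const * exp (\<epsilon> * n k) * exp (- min L (l i * n k)) * real ?C"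
    using mass_const_bounds(2)[of i] by (intro mult_right_mono) auto
  finally have low: "?N \<le> mass_const * exp (\<epsilon> * n k) * exp (- min L (l i * n k)) * real ?C" .
  have Ll: "L \<le> l i * n (Suc k)"
    using k(3) ln_2_le_l[of i] mult_right_mono[of "ln 2" "l i" "n (Suc k)"] by linarith
  have "?N \<le> (2 * exp (- L) + 2 / q i (Suc k)) * q i 0 * loss (Suc k) * real ?C"
    unfolding loss_def by (rule cantor.centres_interval_fraction) (use k in auto)
  also have "\<dots> \<le> (6 * exp (- L)) * q i 0 * (exp (\<epsilon> * n k) * (2 / c * exp (a * n k))) * real ?C"
    unfolding loss_Suc
  proof (intro mult_mono loss_le order_refl)
    have "exp (- (l i * n (Suc k))) \<le> exp (- L)" using Ll by simp
    with inverse_q_le[of i "Suc k"] show "2 * exp (- L) + 2 / q i (Suc k) \<le> 6 * exp (- L)" by linarith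
  qed (use q_bounds(1)[of i 0] loss_pos[of k] c in auto)
  also have "\<dots> = (12 * q i 0 / c) * exp (\<epsilon> * n k) * exp (- (L - a * n k)) * real ?C"
    by (simp add: exp_diff exp_minus field_simps)
  also have "\<dots> \<le> mass_const * exp (\<epsilon> * n k) * exp (- (L - a * n k)) * real ?C"
    using mass_const_bounds(1)[of i] c by (intro mult_right_mono) (auto simp: divide_le_eq)
  finally have high: "?N \<le> mass_const * exp (\<epsilon> * n k) * exp (- (L - a * n k)) * real ?C" .
  have "n k * mass_exponent a (l i) (L / n k) = max (min L (l i * n k)) (L - a * n k)"
  proof -
    have "0 < real (n k)" using n1[of k] by simp
    then show ?thesis
      by (simp add: mass_exponent_def max_mult_distrib_left min_mult_distrib_left right_diff_distrib mult.commute)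
  qed
  then show ?thesis using low high by (auto simp: max_def)
qed

definition boxes :: "nat \<Rightarrow> (real ^ 'n) set" where
  "boxes m = {y. \<forall>i. y $ i \<in> cantor.level i m}"

definition box_centres :: "nat \<Rightarrow> (real ^ 'n) set" where
  "box_centres m = {y. \<forall>i. y $ i \<in> (\<lambda>z. z / q i m) ` cantor.centres i m}"

lemma card_box_centres: "card (box_centres m) = (\<Prod>i\<in>UNIV. card (cantor.centres i m))"
proof -
  have "card ((\<lambda>z. z / q i m) ` cantor.centres i m) = card (cantor.centres i m)" for i
    using cantor.q_pos[of i m] by (intro card_image) (auto simp: inj_on_def)
  then show ?thesis unfolding box_centres_def by (simp add: card_vec_box(1))
qed

lemma finite_box_centres: "finite (box_centres m)"
  unfolding box_centres_def by (rule card_vec_box(2)) (simp add: cantor.finite_centres)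

lemma card_box_centres_pos: "0 < card (box_centres m)"
  unfolding card_box_centres by (intro prod_pos) (simp add: cantor.card_centres_pos)

text \<open>
A ball lies in a cube, whose centres form a product set. The product of the one-dimensional proportions has the
exponent \<open>n k * G(L / n k)\<close>, which is at least \<open>S * L\<close>; the error \<open>exp (CARD('n) * \<epsilon> * n k)\<close> is absorbed by
the difference \<open>S - s\<close> because \<open>L\<close> is at least \<open>ln 2 * n k\<close>.
\<close>
lemma ball_fraction:
  assumes S: "\<And>u. 0 \<le> u \<Longrightarrow> S * u \<le> (\<Sum>i\<in>UNIV. mass_exponent a (l i) u)"
    and sS: "real CARD('n) * \<epsilon> \<le> (S - s) * ln 2"
    and k: "k < m" "ln 2 * n k \<le> - ln r" "- ln r \<le> ln 2 * n (Suc k)" and r: "0 < r"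
  shows "real (card (box_centres m \<inter> ball x r)) \<le> mass_const ^ CARD('n) * r powr s * real (card (box_centres m))"
proof -
  define L where "L = - ln r"
  have rL: "r = exp (- L)" using r by (simp add: L_def)
  let ?I = "\<lambda>i. {z \<in> cantor.centres i m. x $ i - r \<le> z / q i m \<and> z / q i m \<le> x $ i - r + 2 * exp (- L)}"
  let ?G = "\<Sum>i\<in>UNIV. mass_exponent a (l i) (L / n k)"
  have finI: "finite (?I i)" for i by (simp add: cantor.finite_centres)
  have "box_centres m \<inter> ball x r \<subseteq> {y. \<forall>i. y $ i \<in> (\<lambda>z. z / q i m) ` ?I i}"
  proof clarify
    fix y i assume y: "y \<in> box_centres m" "y \<in> ball x r"
    then obtain z where z: "z \<in> cantor.centres i m" "y $ i = z / q i m" by (auto simp: box_centres_def)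
    have "\<bar>x $ i - y $ i\<bar> \<le> r"
      using component_le_norm_cart[of "x - y" i] y(2) by (simp add: dist_norm)
    then have "x $ i - r \<le> z / q i m" "z / q i m \<le> x $ i - r + 2 * exp (- L)"
      unfolding z(2) rL by linarith+
    then show "y $ i \<in> (\<lambda>z. z / q i m) ` ?I i" unfolding z(2) using z(1) by blast
  qed
  then have "card (box_centres m \<inter> ball x r) \<le> card {y :: real ^ 'n. \<forall>i. y $ i \<in> (\<lambda>z. z / q i m) ` ?I i}"
    by (rule card_mono[rotated]) (intro card_vec_box(2) finite_imageI finI)
  also have "\<dots> = (\<Prod>i\<in>UNIV. card ((\<lambda>z. z / q i m) ` ?I i))" by (rule card_vec_box(1))
  also have "\<dots> \<le> (\<Prod>i\<in>UNIV. card (?I i))"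
    by (intro prod_mono conjI card_image_le finI) auto
  finally have "real (card (box_centres m \<inter> ball x r)) \<le> real (\<Prod>i\<in>UNIV. card (?I i))" by (rule of_nat_mono)
  also have "\<dots> = (\<Prod>i\<in>UNIV. real (card (?I i)))" by (rule of_nat_prod)
  also have "\<dots> \<le> (\<Prod>i\<in>UNIV. mass_const * exp (\<epsilon> * n k) * exp (- (n k * mass_exponent a (l i) (L / n k))) *
      real (card (cantor.centres i m)))"
    by (intro prod_mono conjI centres_fraction of_nat_0_le_iff) (use k in \<open>auto simp: L_def\<close>)
  also have "\<dots> = mass_const ^ CARD('n) * (exp (\<epsilon> * n k) ^ CARD('n) *
      (\<Prod>i\<in>UNIV. exp (- (n k * mass_exponent a (l i) (L / n k))))) * real (card (box_centres m))"
    by (simp add: prod.distrib card_box_centres mult.assoc)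
  also have "exp (\<epsilon> * n k) ^ CARD('n) * (\<Prod>i\<in>UNIV. exp (- (n k * mass_exponent a (l i) (L / n k))))
      = exp (real CARD('n) * \<epsilon> * n k - n k * ?G)"
  proof -
    have "(\<Prod>i\<in>UNIV. exp (- (n k * mass_exponent a (l i) (L / n k)))) = exp (- (n k * ?G))"
      by (subst exp_sum[symmetric]) (simp_all add: sum_negf sum_distrib_left)
    moreover have "exp (\<epsilon> * n k) ^ CARD('n) = exp (real CARD('n) * \<epsilon> * n k)"
      by (simp add: mult.assoc flip: exp_of_nat_mult)
    ultimately show ?thesis by (simp flip: exp_add)
  qed
  also have "mass_const ^ CARD('n) * exp (real CARD('n) * \<epsilon> * n k - n k * ?G) * real (card (box_centres m))
      \<le> mass_const ^ CARD('n) * exp (- s * L) * real (card (box_centres m))"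
  proof (intro mult_right_mono mult_left_mono)
    have nk: "0 < real (n k)" using n1[of k] by simp
    have "0 \<le> ln 2 * real (n k)" by simp
    then have L0: "0 \<le> L" unfolding L_def using k(2) by (rule order_trans)
    have "S * L = n k * (S * (L / n k))" using nk by simp
    also have "\<dots> \<le> n k * ?G" using nk L0 by (intro mult_left_mono S) auto
    finally have "S * L \<le> n k * ?G" .
    moreover have "real CARD('n) * \<epsilon> * n k \<le> (S - s) * L"
    proof -
      have "0 < (S - s) * ln 2" using sS \<epsilon> by (smt (verit) mult_pos_pos of_nat_0_less_iff zero_less_card_finite)
      then have "0 \<le> S - s" by (simp add: zero_less_mult_iff)
      then have "(S - s) * (ln 2 * n k) \<le> (S - s) * L" using k(2) by (intro mult_left_mono) (auto simp: L_def)
      moreover have "real CARD('n) * \<epsilon> * n k \<le> (S - s) * ln 2 * n k" using sS by (intro mult_right_mono) auto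
      ultimately show ?thesis by (simp add: mult.assoc)
    qed
    ultimately show "exp (real CARD('n) * \<epsilon> * n k - n k * ?G) \<le> exp (- s * L)"
      by (simp add: algebra_simps)
  qed (use mass_const_bounds(3) in auto)
  also have "exp (- s * L) = r powr s" using r by (simp add: powr_def L_def)
  finally show ?thesis .
qed

text \<open>
Every small radius falls between \<open>exp (- ln 2 * n k)\<close> and \<open>exp (- ln 2 * n (k + 1))\<close> for some \<open>k\<close>. For radii above
\<open>exp (- ln 2 * n 0)\<close> the trivial bound suffices after enlarging the constant.
\<close>
lemma hausdorff_measure_Inter_boxes:
  assumes S: "\<And>u. 0 \<le> u \<Longrightarrow> S * u \<le> (\<Sum>i\<in>UNIV. mass_exponent a (l i) u)"
    and sS: "real CARD('n) * \<epsilon> \<le> (S - s) * ln 2" and s: "0 < s"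
  shows "hausdorff_measure s (\<Inter>m. boxes m) \<noteq> 0"
proof -
  define r0 where "r0 = exp (- (ln 2 * n 0))"
  define B where "B = max (mass_const ^ CARD('n)) (1 / r0 powr s)"
  have B: "mass_const ^ CARD('n) \<le> B" "1 / r0 powr s \<le> B" "0 < B" by (auto simp: B_def r0_def less_max_iff_disj)
  show ?thesis
  proof (rule mass_distribution[where C = box_centres and K = B])
    show "compact (boxes m)" for m unfolding boxes_def by (intro compact_vec_box cantor.compact_level)
    show "boxes (Suc m) \<subseteq> boxes m" for m unfolding boxes_def using cantor.level_Suc_subset by blast
    show "finite (box_centres m)" for m by (rule finite_box_centres)
    show "box_centres m \<noteq> {}" for m using card_box_centres_pos[of m] by auto
    show "box_centres m \<subseteq> boxes m" for m unfolding box_centres_def boxes_def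
    proof clarify
      fix y i assume "\<forall>i. y $ i \<in> (\<lambda>z. real_of_int z / q i m) ` cantor.centres i m"
      then obtain z where "z \<in> cantor.centres i m" "y $ i = z / q i m" by blast
      then show "y $ i \<in> cantor.level i m" using cantor.centre_in_level by simp
    qed
    fix r :: real assume r: "0 < r"
    show "\<forall>\<^sub>F m in sequentially. \<forall>x. real (card (box_centres m \<inter> ball x r)) \<le> B * r powr s * real (card (box_centres m))"
    proof (cases "r \<le> r0")
      case True
      then have "ln r \<le> ln r0" using r by simp
      then have start: "ln 2 * n 0 \<le> - ln r" by (simp add: r0_def)
      have "\<exists>k. ln 2 * n k \<le> - ln r \<and> - ln r \<le> ln 2 * n (Suc k)"
      proof (rule ccontr)
        assume no: "\<nexists>k. ln 2 * n k \<le> - ln r \<and> - ln r \<le> ln 2 * n (Suc k)"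
        have all: "ln 2 * n k \<le> - ln r" for k
        proof (induction k)
          case (Suc k)
          then show ?case using no by (meson linear)
        qed (rule start)
        obtain M :: nat where M: "- ln r / ln 2 < M" using reals_Archimedean2 by blast
        have "real M \<le> n M" using n_mono by (simp add: strict_mono_imp_increasing)
        then have "- ln r / ln 2 < n M" using M by linarith
        then have "- ln r < n M * ln 2" by (subst (asm) pos_divide_less_eq) auto
        then have "- ln r < ln 2 * n M" by (simp only: mult.commute)
        then show False using all[of M] by simp
      qed
      then obtain k where k: "ln 2 * n k \<le> - ln r" "- ln r \<le> ln 2 * n (Suc k)" by blast
      have "real (card (box_centres m \<inter> ball x r)) \<le> B * r powr s * real (card (box_centres m))" if "k < m" for m x
      proof -
        have "real (card (box_centres m \<inter> ball x r)) \<le> mass_const ^ CARD('n) * r powr s * real (card (box_centres m))"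
          using S sS that k r by (rule ball_fraction)
        also have "\<dots> \<le> B * r powr s * real (card (box_centres m))" using B by (intro mult_right_mono) auto
        finally show ?thesis .
      qed
      then show ?thesis by (intro eventually_sequentiallyI[of "Suc k"]) (simp add: Suc_le_eq)
    next
      case False
      then have "r0 powr s \<le> r powr s" using s by (intro powr_mono2) (auto simp: r0_def)
      then have "1 \<le> 1 / r0 powr s * r powr s" by (simp add: r0_def)
      also have "\<dots> \<le> B * r powr s" using B by (intro mult_right_mono) auto
      finally have big: "1 \<le> B * r powr s" .
      have "real (card (box_centres m \<inter> ball x r)) \<le> B * r powr s * real (card (box_centres m))" for m x
      proof -
        have "real (card (box_centres m \<inter> ball x r)) \<le> 1 * real (card (box_centres m))"
          using card_mono[OF finite_box_centres, of "box_centres m \<inter> ball x r" m] by simp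
        also have "\<dots> \<le> B * r powr s * real (card (box_centres m))"
          using big by (intro mult_right_mono) auto
        finally show ?thesis .
      qed
      then show ?thesis by simp
    qed
  qed (use s B in auto)
qed

lemma Inter_boxes_bound:
  assumes "y \<in> (\<Inter>m. boxes m)"
  shows "y $ i \<in> {0..c}"
proof -
  have "y \<in> boxes 0" using assms by blast
  then have "y $ i \<in> {0 .. \<delta> 0 / q i 0}" by (simp add: boxes_def cantor.level_0)
  moreover have "\<delta> 0 / q i 0 \<le> c / 1"
    using \<delta>_bounds[of 0] q_bounds(1)[of i 0] c by (intro frac_le) auto
  ultimately show ?thesis by simp
qed

lemma Inter_boxes_recurrent:
  assumes y: "y \<in> (\<Inter>m. boxes m)"
  shows "\<exists>z :: int. \<bar>(of_int (\<mu> i) ^ n m - 1) * y $ i - z\<bar> \<le> c * exp (- a * n m)"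
proof -
  have "y \<in> boxes m" using y by blast
  then obtain z :: int where z: "z / q i m \<le> y $ i" "y $ i \<le> (z + \<delta> m) / q i m"
    unfolding boxes_def cantor.level_def by auto
  have "z \<le> q i m * y $ i" "q i m * y $ i \<le> z + \<delta> m"
    using z q_bounds(1)[of i m] by (simp_all add: field_simps)
  then have le: "\<bar>q i m * y $ i - z\<bar> \<le> \<delta> m" by simp
  show ?thesis
  proof (cases "0 \<le> (of_int (\<mu> i) ^ n m - 1 :: real)")
    case True
    then show ?thesis using le by (intro exI[of _ z]) (simp add: q_def \<delta>_def)
  next
    case False
    then have "(of_int (\<mu> i) ^ n m - 1) * y $ i - of_int (- z) = - (q i m * y $ i - z)"
      by (simp add: q_def algebra_simps)
    then have "\<bar>(of_int (\<mu> i) ^ n m - 1) * y $ i - of_int (- z)\<bar> \<le> \<delta> m"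
      using le by (simp only: abs_minus_cancel)
    then show ?thesis unfolding \<delta>_def by blast
  qed
qed

end

text \<open>
The lower bound in eigencoordinates. The strict inequalities \<open>crit\<close> leave room for some \<open>S > s\<close>, and that room
fixes the admissible error \<open>\<epsilon>\<close>, hence the ratio \<open>R\<close> of the times. The bound \<open>c\<close> on the
coordinates keeps \<open>E\<close> so small that the projection to the torus can be inverted on it.
\<close>
lemma recurrent_cantor_set:
  fixes \<mu> :: "'n :: finite \<Rightarrow> int" and a c s :: real and Q :: "nat set"
  defines "l \<equiv> \<lambda>i. ln \<bar>real_of_int (\<mu> i)\<bar>"
  assumes \<mu>: "\<And>i. 2 \<le> \<bar>\<mu> i\<bar>" and a: "0 < a" and c: "0 < c" "c < 1" and Q: "infinite Q" and s: "0 < s"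
    and crit: "\<And>j. s * (l j + a) < (\<Sum>i\<in>UNIV. mass_exponent a (l i) (l j + a))"
  obtains E :: "(real ^ 'n) set" where "hausdorff_measure s E \<noteq> 0"
    "\<And>y i. y \<in> E \<Longrightarrow> y $ i \<in> {0..c}"
    "\<And>y. y \<in> E \<Longrightarrow> \<exists>\<^sub>F n in sequentially. n \<in> Q \<and>
       (\<forall>i. \<exists>z :: int. \<bar>(of_int (\<mu> i) ^ n - 1) * y $ i - z\<bar> \<le> c * exp (- a * n))"
proof -
  have l0: "0 < l i" for i
  proof -
    have "1 < \<bar>real_of_int (\<mu> i)\<bar>" using \<mu>[of i] by linarith
    then show ?thesis by (simp add: l_def)
  qed
  let ?G = "\<lambda>u. \<Sum>i\<in>UNIV. mass_exponent a (l i) u"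
  define S where "S = Min (range (\<lambda>j. ?G (l j + a) / (l j + a)))"
  have "S \<in> range (\<lambda>j. ?G (l j + a) / (l j + a))" unfolding S_def by (rule Min_in) auto
  then obtain j where "S = ?G (l j + a) / (l j + a)" by auto
  then have sS: "s < S" using crit[of j] l0[of j] a by (simp add: pos_less_divide_eq)
  have "S * (l j + a) \<le> ?G (l j + a)" for j
  proof -
    have "S \<le> ?G (l j + a) / (l j + a)" unfolding S_def by (rule Min_le) auto
    then show ?thesis using l0[of j] a by (simp add: pos_le_divide_eq)
  qed
  then have G: "S * u \<le> ?G u" if "0 \<le> u" for u
    using mass_exponent_sum_ge[of a l S u] a l0 that by auto
  \<comment> \<open>The largest error that \<open>ball_fraction\<close> can absorb.\<close>
  define \<epsilon> where "\<epsilon> = (S - s) * ln 2 / real CARD('n)"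
  have \<epsilon>: "0 < \<epsilon>" "real CARD('n) * \<epsilon> \<le> (S - s) * ln 2" using sS by (simp_all add: \<epsilon>_def)
  \<comment> \<open>The ratio \<open>R = R0 + 1\<close> serves both \<open>gap\<close> and \<open>subexp\<close>; the first time has to exceed \<open>ln (16 / c)\<close>.\<close>
  obtain R0 :: nat where R0: "max ((a + 1) / \<epsilon>) ((a + 1) / ln 2) \<le> R0" using real_arch_simple by blast
  define R where "R = Suc R0"
  have R1: "1 \<le> R" by (simp add: R_def)
  have "(a + 1) / \<epsilon> \<le> real R - 1" "(a + 1) / ln 2 \<le> real R - 1" using R0 by (simp_all add: R_def)
  then have R: "a + 1 \<le> (real R - 1) * \<epsilon>" "a + 1 \<le> (real R - 1) * ln 2"
    using \<epsilon>(1) by (simp_all add: pos_divide_le_eq)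
  obtain N :: nat where N: "max (ln (16 / c)) 1 \<le> N" using real_arch_simple by blast
  obtain n where n: "\<And>k. n k \<in> Q" "N \<le> n 0" "\<And>k. R * n k \<le> n (Suc k)" "\<And>k. n k < n (Suc k)"
    using lacunary_sequence[OF Q R1] by metis
  have n_mono: "strict_mono n" using n(4) by (simp add: strict_mono_Suc_iff)
  have nN: "max (ln (16 / c)) 1 \<le> n k" for k
  proof -
    have "n 0 \<le> n k" using strict_mono_less_eq[OF n_mono] by simp
    then show ?thesis using N n(2) by linarith
  qed
  have Rn: "real R * n k \<le> n (Suc k)" for k
    using of_nat_mono[OF n(3)[of k], where 'a = real] by simp
  interpret rs: recurrence_scheme \<mu> a c \<epsilon> n
  proof
    fix k
    show "1 \<le> n k" using nN[of k] by simp
    have "ln (16 / c) \<le> n k" using nN[of k] by simp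
    then have "exp (ln (16 / c)) \<le> exp (n k)" by (simp only: exp_le_cancel_iff)
    then show "16 / c \<le> exp (n k)" using c by simp
    have "(a + 1) * n k \<le> (real R - 1) * ln 2 * n k" using R by (intro mult_right_mono) auto
    also have "\<dots> = ln 2 * (real R * n k - n k)" by (simp add: algebra_simps)
    also have "\<dots> \<le> ln 2 * (real (n (Suc k)) - n k)" using Rn[of k] by (intro mult_left_mono) auto
    finally show "(a + 1) * n k \<le> ln 2 * (real (n (Suc k)) - n k)" .
    have "(\<epsilon> + a + 1) * n k \<le> (\<epsilon> * R) * n k" using R(1) by (intro mult_right_mono) (auto simp: algebra_simps)
    also have "\<dots> = \<epsilon> * (R * n k)" by simp
    also have "\<dots> \<le> \<epsilon> * n (Suc k)" using Rn[of k] \<epsilon>(1) by (intro mult_left_mono) auto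
    finally show "(\<epsilon> + a + 1) * n k \<le> \<epsilon> * n (Suc k)" .
  qed (use \<mu> a c \<epsilon>(1) n_mono in auto)
  have l_eq: "rs.l = l"
    by (simp add: fun_eq_iff rs.l_def l_def)
  show thesis
  proof (rule that)
    show "hausdorff_measure s (\<Inter>m. rs.boxes m) \<noteq> 0"
      using G \<epsilon>(2) s by (intro rs.hausdorff_measure_Inter_boxes[of S]) (simp_all add: l_eq)
    fix y assume y: "y \<in> (\<Inter>m. rs.boxes m)"
    show "y $ i \<in> {0..c}" for i using y by (rule rs.Inter_boxes_bound)
    have "m \<le> n m" for m using n_mono by (rule strict_mono_imp_increasing)
    then show "\<exists>\<^sub>F n in sequentially. n \<in> Q \<and>
       (\<forall>i. \<exists>z :: int. \<bar>(of_int (\<mu> i) ^ n - 1) * y $ i - z\<bar> \<le> c * exp (- a * n))"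
      unfolding frequently_sequentially using n(1) rs.Inter_boxes_recurrent[OF y] by blast
  qed
qed

section \<open>Integer eigenbases\<close>

lemma det_of_int: "det (map_matrix of_int X) = (of_int (det X) :: 'b :: comm_ring_1)"
  for X :: "int ^ 'n ^ 'n"
  by (simp add: det_def map_matrix_def)

text \<open>
Evaluation of polynomials is a ring homomorphism, so it commutes with the determinant.
\<close>
lemma poly_charpoly: "poly (charpoly M) x = det (mat x - M)"
  for M :: "'a :: comm_ring_1 ^ 'n ^ 'n"
proof -
  have "poly ((mat [:0, 1:] - map_matrix (\<lambda>a. [:a:]) M) $ i $ j) x = (mat x - M) $ i $ j" for i j
    by (simp add: mat_def map_matrix_def)
  then show ?thesis
    by (simp add: charpoly_def det_def poly_sum poly_prod)
qed

lemma matrix_inv_mult: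
  assumes "invertible M"
  shows "M ** matrix_inv M = mat 1" "matrix_inv M ** M = mat 1"
  using someI_ex[OF assms[unfolded invertible_def]] unfolding matrix_inv_def by auto

lemma matrix_diff_ldistrib: "(A :: 'a :: ring_1 ^ 'n ^ 'm) ** (B - C) = A ** B - A ** C"
  by (simp add: matrix_matrix_mult_def vec_eq_iff sum_subtractf right_diff_distrib)

lemma matrix_diff_rdistrib: "((B :: 'a :: ring_1 ^ 'n ^ 'm) - C) ** A = B ** A - C ** A"
  by (simp add: matrix_matrix_mult_def vec_eq_iff sum_subtractf left_diff_distrib)

lemma det_mat_minus_conjugate:
  fixes P D :: "'a :: field ^ 'n ^ 'n"
  assumes P: "invertible P"
  shows "det (mat x - P ** D ** matrix_inv P) = det (mat x - D)"
proof -
  have inv: "P ** matrix_inv P = mat 1" by (rule matrix_inv_mult(1)[OF P])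
  have "mat x = P ** mat x ** matrix_inv P"
  proof -
    have "P ** mat x = mat x ** P"
      by (simp add: matrix_matrix_mult_def mat_def vec_eq_iff if_distrib if_distribR mult.commute cong: if_cong)
    then show ?thesis by (simp add: inv flip: matrix_mul_assoc)
  qed
  then have "mat x - P ** D ** matrix_inv P = P ** (mat x - D) ** matrix_inv P"
    by (simp add: matrix_diff_ldistrib matrix_diff_rdistrib)
  moreover have "det P * det (matrix_inv P) = 1"
    using inv by (metis det_I det_mul)
  ultimately show ?thesis by (simp add: det_mul mult.commute mult.left_commute)
qed

text \<open>
Both products have the same multiset of roots, so a bijection of the index sets matches the roots.
\<close>
lemma prod_linear_eq_imp_bij:
  fixes f :: "'i \<Rightarrow> 'a :: idom" and g :: "'j \<Rightarrow> 'a"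
  assumes fin: "finite I" "finite J" and card: "card I = card J"
    and eq: "(\<Prod>i\<in>I. [:- f i, 1:]) = (\<Prod>j\<in>J. [:- g j, 1:])"
  obtains \<tau> where "bij_betw \<tau> I J" "\<And>i. i \<in> I \<Longrightarrow> f i = g (\<tau> i)"
proof -
  have proots: "proots (\<Prod>i\<in>A. [:- h i, 1:]) = image_mset h (mset_set A)"
    if "finite A" for h :: "'c \<Rightarrow> 'a" and A
    using that by (subst proots_prod) (auto, induction A rule: finite_induct, auto)
  obtain b where b: "bij_betw b I J" using fin card by (rule finite_same_card_bij[elim_format]) auto
  have "image_mset f (mset_set I) = image_mset g (mset_set J)"
    using eq proots[OF fin(1), of f] proots[OF fin(2), of g] by simp
  also have "mset_set J = image_mset b (mset_set I)"
    using b by (simp add: bij_betw_def image_mset_mset_set)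
  finally have "image_mset f (mset_set I) = image_mset (g \<circ> b) (mset_set I)"
    by (simp add: multiset.map_comp)
  then obtain p where p: "p permutes I" "\<forall>x\<in>I. f x = (g \<circ> b) (p x)"
    using image_mset_eq_implies_permutes[OF fin(1)] by blast
  show thesis
  proof
    show "bij_betw (b \<circ> p) I J" using b p(1) by (meson bij_betw_trans permutes_imp_bij)
    show "f i = g ((b \<circ> p) i)" if "i \<in> I" for i using p(2) that by simp
  qed
qed

lemma common_denominator:
  fixes S :: "rat set"
  assumes "finite S"
  shows "\<exists>N :: int. N > 0 \<and> (\<forall>x\<in>S. of_int N * x \<in> \<int>)"
  using assms
proof induction
  case empty
  show ?case by (intro exI[of _ 1]) simp
next
  case (insert x S)
  then obtain N where N: "N > 0" "\<forall>x\<in>S. of_int N * x \<in> \<int>" by blast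
  obtain a b where x: "x = Fract a b" "b > 0" by (cases x)
  have "of_int (N * b) * y \<in> \<int>" if "y \<in> insert x S" for y
  proof (cases "y = x")
    case True
    have "of_int (N * b) * x = of_int (N * a)" using x by (simp add: Fract_of_int_quotient)
    then show ?thesis by (simp only: True Ints_of_int)
  next
    case False
    then have "of_int b * (of_int N * y) \<in> \<int>" using N that by (intro Ints_mult[of "of_int b"]) auto
    then show ?thesis by (simp only: of_int_mult mult_ac)
  qed
  then show ?case using N x by (intro exI[of _ "N * b"]) auto
qed

lemma integral_multiple:
  fixes P :: "rat ^ 'n ^ 'm"
  obtains N :: int where "N > 0" "\<And>i j. of_int N * of_rat (P $ i $ j) \<in> (\<int> :: real set)"
proof -
  have "finite (range (\<lambda>(i, j). P $ i $ j))" by simp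
  then obtain N :: int where N: "N > 0" "\<forall>x\<in>range (\<lambda>(i, j). P $ i $ j). of_int N * x \<in> \<int>"
    using common_denominator by blast
  have "of_int N * of_rat (P $ i $ j) \<in> (\<int> :: real set)" for i j
  proof -
    have "of_int N * P $ i $ j \<in> \<int>" using N(2) by auto
    then obtain z where "of_int N * P $ i $ j = of_int z" by (auto elim: Ints_cases)
    then have "(of_rat (of_int N * P $ i $ j) :: real) = of_int z" by simp
    then show ?thesis by (simp add: of_rat_mult)
  qed
  with N(1) show thesis by (rule that)
qed

lemma map_matrix_of_rat_mult:
  "map_matrix of_rat (P ** Q) = (map_matrix of_rat P ** map_matrix of_rat Q :: real ^ 'n ^ 'm)"
  by (simp add: map_matrix_def matrix_matrix_mult_def of_rat_sum of_rat_mult)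

text \<open>
The integer and the rational characteristic polynomial agree at all integers, which identifies the diagonal entries
of \<open>D\<close> with the numbers \<open>lam\<close> up to a bijection \<open>\<tau>\<close>. Clearing denominators in \<open>P\<close> and in its inverse makes the entries integers.
There are two matrices, one for each direction of the change of coordinates: both have to map the lattice into
itself, and the inverse of an integer matrix need not do so.
\<close>
lemma integer_eigenbases:
  fixes A :: "int ^ 'n ^ 'n" and lam :: "nat \<Rightarrow> int"
  assumes diag: "diagonalizable (map_matrix rat_of_int A)"
    and char: "charpoly A = (\<Prod>i = 1..CARD('n). [:- lam i, 1:])"
  obtains \<tau> :: "'n \<Rightarrow> nat" and B B' :: "real ^ 'n ^ 'n"
  where "bij_betw \<tau> UNIV {1..CARD('n)}" "invertible B" "invertible B'"
    "\<And>i j. B $ i $ j \<in> \<int>" "\<And>i j. B' $ i $ j \<in> \<int>"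
    "\<And>x. B *v (map_matrix of_int A *v x) = (\<chi> i. of_int (lam (\<tau> i)) * (B *v x) $ i)"
    "\<And>y. map_matrix of_int A *v (B' *v y) = B' *v (\<chi> i. of_int (lam (\<tau> i)) * y $ i)"
proof -
  obtain P D :: "rat ^ 'n ^ 'n" where P: "invertible P" and D: "\<And>i j. i \<noteq> j \<Longrightarrow> D $ i $ j = 0"
    and A: "map_matrix rat_of_int A = P ** D ** matrix_inv P"
    using diag by (auto simp: diagonalizable_def)
  have "(\<Prod>i\<in>UNIV. [:- D $ i $ i, 1:]) = (\<Prod>i = 1..CARD('n). [:- rat_of_int (lam i), 1:])" (is "?p = ?q")
  proof -
    have "poly ?p (of_int x) = poly ?q (of_int x)" for x :: int
    proof -
      have "poly ?p (of_int x) = (\<Prod>i\<in>UNIV. (mat (of_int x) - D) $ i $ i)"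
        by (simp add: poly_prod mat_def)
      also have "\<dots> = det (mat (of_int x) - D)"
        by (rule det_diagonal[symmetric]) (use D in \<open>auto simp: mat_def\<close>)
      also have "\<dots> = det (mat (of_int x) - map_matrix rat_of_int A)"
        by (simp add: A det_mat_minus_conjugate[OF P])
      also have "mat (of_int x) - map_matrix rat_of_int A = map_matrix of_int (mat x - A)"
        by (simp add: mat_def map_matrix_def vec_eq_iff)
      also have "det \<dots> = of_int (poly (charpoly A) x)"
        by (simp add: det_of_int poly_charpoly)
      also have "\<dots> = poly ?q (of_int x)" by (simp add: char poly_prod)
      finally show ?thesis .
    qed
    then have "range rat_of_int \<subseteq> {x. poly (?p - ?q) x = 0}" by auto
    moreover have "infinite (range rat_of_int)" using infinite_UNIV_int by (simp add: finite_image_iff inj_on_def)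
    ultimately have "?p - ?q = 0" using poly_roots_finite finite_subset by blast
    then show ?thesis by simp
  qed
  then obtain \<tau> :: "'n \<Rightarrow> nat" where \<tau>: "bij_betw \<tau> UNIV {1..CARD('n)}"
      "\<And>i. D $ i $ i = of_int (lam (\<tau> i))"
    by (rule prod_linear_eq_imp_bij[rotated 3]) auto
  define R where "R = (map_matrix of_rat :: rat ^ 'n ^ 'n \<Rightarrow> real ^ 'n ^ 'n)"
  define Q where "Q = matrix_inv P"
  have PQ: "P ** Q = mat 1" "Q ** P = mat 1"
    unfolding Q_def using matrix_inv_mult[OF P] by auto
  have R1: "R (mat 1) = mat 1" by (simp add: R_def map_matrix_def mat_def vec_eq_iff)
  have RA: "map_matrix of_int A = R (map_matrix rat_of_int A)"
    by (simp add: R_def map_matrix_def vec_eq_iff)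
  have Rm: "R (X ** Y) = R X ** R Y" for X Y by (simp add: R_def map_matrix_of_rat_mult)
  have RD: "R D *v y = (\<chi> i. of_int (lam (\<tau> i)) * y $ i)" for y
  proof -
    have eq: "R D $ i $ j = (if i = j then of_int (lam (\<tau> i)) else 0)" for i j
      using D \<tau>(2)[of i] by (auto simp: R_def map_matrix_def)
    show ?thesis by (simp add: matrix_vector_mult_def eq if_distrib[of "\<lambda>c. c * _"] cong: if_cong)
  qed
  have AP: "map_matrix of_int A ** R P = R P ** R D"
    unfolding RA A using PQ by (metis Q_def Rm R1 matrix_mul_assoc matrix_mul_rid)
  have QA: "R Q ** map_matrix of_int A = R D ** R Q"
    unfolding RA A using PQ by (metis Q_def Rm R1 matrix_mul_assoc matrix_mul_lid)
  obtain N where N: "N > 0" "\<And>i j. of_int N * of_rat (Q $ i $ j) \<in> (\<int> :: real set)"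
    using integral_multiple[of Q] by blast
  obtain N' where N': "N' > 0" "\<And>i j. of_int N' * of_rat (P $ i $ j) \<in> (\<int> :: real set)"
    using integral_multiple[of P] by blast
  have inv: "invertible (R P)" "invertible (R Q)"
    using PQ unfolding invertible_def by (metis Rm R1)+
  show thesis
  proof (rule that[of \<tau> "of_int N *\<^sub>R R Q" "of_int N' *\<^sub>R R P"])
    show "invertible (of_int N *\<^sub>R R Q)" "invertible (of_int N' *\<^sub>R R P)"
      using inv N N' by (auto intro!: scalar_invertible)
    show "(of_int N *\<^sub>R R Q) $ i $ j \<in> \<int>" for i j using N(2)[of i j] by (simp add: R_def map_matrix_def)
    show "(of_int N' *\<^sub>R R P) $ i $ j \<in> \<int>" for i j using N'(2)[of i j] by (simp add: R_def map_matrix_def)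
    show "of_int N *\<^sub>R R Q *v (map_matrix of_int A *v x) =
        (\<chi> i. of_int (lam (\<tau> i)) * (of_int N *\<^sub>R R Q *v x) $ i)" for x
    proof -
      have "R Q *v (map_matrix of_int A *v x) = (\<chi> i. of_int (lam (\<tau> i)) * (R Q *v x) $ i)"
        by (metis QA RD matrix_vector_mul_assoc)
      then show ?thesis by (simp add: scaleR_matrix_vector_assoc[symmetric] vec_eq_iff mult_ac)
    qed
    show "map_matrix of_int A *v (of_int N' *\<^sub>R R P *v y) =
        of_int N' *\<^sub>R R P *v (\<chi> i. of_int (lam (\<tau> i)) * y $ i)" for y
    proof -
      have "map_matrix of_int A *v (R P *v y) = R P *v (\<chi> i. of_int (lam (\<tau> i)) * y $ i)"
        by (metis AP RD matrix_vector_mul_assoc)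
      then show ?thesis by (simp add: scaleR_matrix_vector_assoc[symmetric] matrix_vector_mult_scaleR)
    qed
  qed (use \<tau> in auto)
qed

section \<open>Transfer to the torus\<close>

lemma torus_map_torus_of: "torus_map A (torus_of x) = torus_of (map_matrix real_of_int A *v x)"
  by (rule torus_map.abs_eq)

lemma torus_map_power_torus_of:
  "(torus_map A ^^ n) (torus_of x) = torus_of (((*v) (map_matrix real_of_int A) ^^ n) x)"
  by (induction n) (simp_all add: torus_map_torus_of)

lemma dist_torus_of_le: "dist (torus_of x) (torus_of y) \<le> dist x y"
  by (rule torus_dist_le) (rule refl)+

text \<open>
A shorter representative would differ from \<open>y\<close> by a nonzero lattice vector of norm below \<open>1\<close>.
\<close>
lemma dist_le_dist_torus_of:
  assumes "dist x y \<le> 1 / 2"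
  shows "dist x y \<le> dist (torus_of x) (torus_of y)"
proof (rule ccontr)
  assume "\<not> dist x y \<le> dist (torus_of x) (torus_of y)"
  then obtain z where z: "torus_of z = torus_of y" "dist x z < dist x y"
    using torus_dist_lessE[of x "torus_of y" "dist x y"] by (metis not_le)
  have "y - z \<in> int_lattice" "y - z \<noteq> 0"
    using z torus_of_eq_iff[of y z] by auto
  then have "1 \<le> dist y z" unfolding dist_norm by (rule int_lattice_norm_ge_1)
  then show False using dist_triangle3[of y z x] z(2) assms by linarith
qed

lemma int_matrix_int_lattice:
  assumes "\<And>i j. B $ i $ j \<in> \<int>" "k \<in> int_lattice"
  shows "B *v k \<in> int_lattice"
  using assms by (auto simp: int_lattice_def matrix_vector_mult_def intro!: Ints_sum Ints_mult)

lemma matrix_vector_norm_bound: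
  fixes B :: "real ^ 'n ^ 'm"
  obtains K where "0 < K" "\<And>x. norm (B *v x) \<le> K * norm x"
  using bounded_linear.pos_bounded[OF matrix_vector_mul_bounded_linear[of B]] by (metis mult.commute)

text \<open>
With \<open>y = B x\<close> the displacement \<open>T\<^sup>n x - x\<close> modulo the lattice becomes \<open>(\<mu>\<^sub>i\<^sup>n - 1) y\<^sub>i\<close> modulo integers, because \<open>B\<close>
maps the lattice into itself. So the recurrence set is contained in a Lipschitz image of the null set of
\<open>recurrent_points_null\<close>.
\<close>
lemma recurrence_set_hausdorff_null:
  fixes A :: "int ^ 'n ^ 'n" and B :: "real ^ 'n ^ 'n" and \<mu> :: "'n \<Rightarrow> int"
  defines "l \<equiv> \<lambda>i. ln \<bar>real_of_int (\<mu> i)\<bar>"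
  assumes \<mu>: "\<And>i. 2 \<le> \<bar>\<mu> i\<bar>" and B: "invertible B" "\<And>i j. B $ i $ j \<in> \<int>"
    and BA: "\<And>x. B *v (map_matrix of_int A *v x) = (\<chi> i. of_int (\<mu> i) * (B *v x) $ i)"
    and t: "0 \<le> t" and psi: "\<forall>\<^sub>F n in sequentially. psi n \<le> exp (- t * real n)" and s: "0 < s"
    and crit: "(\<Sum>i\<in>UNIV. mass_exponent t (l i) (l j + t)) < s * (l j + t)"
  shows "hausdorff_measure s (recurrence_set (torus_map A) psi) = 0"
proof -
  obtain B' where B': "B' ** B = mat 1" using B(1) unfolding invertible_def by blast
  obtain K where K: "0 < K" "\<And>x. norm (B *v x) \<le> K * norm x" using matrix_vector_norm_bound[of B] by blast
  obtain K' where K': "0 < K'" "\<And>x. norm (B' *v x) \<le> K' * norm x" using matrix_vector_norm_bound[of B'] by blast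
  define M where "M = K * real CARD('n)"
  define E where "E = {y :: real ^ 'n. \<exists>\<^sub>F n in sequentially.
    \<forall>i. y $ i \<in> near_periodic (\<mu> i) M (K * exp (- t * n)) n}"
  have null: "hausdorff_measure s E = 0"
    unfolding E_def by (rule recurrent_points_null[OF \<mu> t _ _ s crit[unfolded l_def]]) (use K(1) in \<open>auto simp: M_def\<close>)
  define g where "g y = torus_of (B' *v y)" for y
  have "K'-lipschitz_on E g"
  proof (rule lipschitz_onI)
    fix x y :: "real ^ 'n"
    have "dist (g x) (g y) \<le> dist (B' *v x) (B' *v y)" unfolding g_def by (rule dist_torus_of_le)
    also have "\<dots> = norm (B' *v (x - y))" by (simp add: dist_norm matrix_vector_mult_diff_distrib)
    also have "\<dots> \<le> K' * dist x y" unfolding dist_norm by (rule K')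
    finally show "dist (g x) (g y) \<le> K' * dist x y" .
  qed (use K' in simp)
  with s null have "hausdorff_measure s (g ` E) = 0" by (rule hausdorff_null_lipschitz_image)
  moreover have "recurrence_set (torus_map A) psi \<subseteq> g ` E"
  proof
    fix X assume X: "X \<in> recurrence_set (torus_map A) psi"
    obtain x0 where x0: "X = torus_of x0" using torus_of_surj by blast
    \<comment> \<open>The representative in the unit cube, which bounds \<open>B *v x\<close> uniformly in \<open>X\<close>.\<close>
    define x where "x = (\<chi> i. frac (x0 $ i))"
    have "x0 - x \<in> int_lattice" by (simp add: x_def int_lattice_def frac_def)
    then have x: "X = torus_of x" by (simp add: x0 torus_of_eq_iff)
    have "norm x \<le> (\<Sum>i\<in>UNIV. \<bar>x $ i\<bar>)" by (rule norm_le_l1_cart)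
    also have "\<dots> \<le> real CARD('n)"
      using sum_bounded_above[of UNIV "\<lambda>i. \<bar>x $ i\<bar>" 1] by (simp add: x_def frac_lt_1 less_imp_le)
    finally have "K * norm x \<le> M" unfolding M_def using K(1) by (intro mult_left_mono) auto
    then have M: "\<bar>(B *v x) $ i\<bar> \<le> M" for i
      using component_le_norm_cart[of "B *v x" i] K(2)[of x] by linarith
    have power: "(B *v (((*v) (map_matrix real_of_int A) ^^ n) x)) $ i = of_int (\<mu> i) ^ n * (B *v x) $ i" for n i
      by (induction n) (simp_all add: BA)
    have near: "(B *v x) $ i \<in> near_periodic (\<mu> i) M (K * exp (- t * n)) n"
      if n: "(torus_map A ^^ n) X \<in> ball X (psi n)" "psi n \<le> exp (- t * n)" for n i
    proof -
      let ?w = "((*v) (map_matrix real_of_int A) ^^ n) x"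
      have "dist (torus_of x) (torus_of ?w) < psi n" using n(1) by (simp add: x torus_map_power_torus_of)
      then obtain y where y: "torus_of y = torus_of ?w" "dist x y < psi n" by (rule torus_dist_lessE)
      have "B *v (?w - y) \<in> int_lattice"
        using y(1) by (intro int_matrix_int_lattice B) (metis torus_of_eq_iff)
      then obtain z :: int where z: "(B *v (?w - y)) $ i = z" by (auto simp: int_lattice_def elim: Ints_cases)
      have "(of_int (\<mu> i) ^ n - 1) * (B *v x) $ i - z = (B *v (y - x)) $ i"
        unfolding z[symmetric] by (simp add: matrix_vector_mult_diff_distrib power algebra_simps)
      also have "\<bar>\<dots>\<bar> \<le> K * norm (y - x)"
        using component_le_norm_cart[of "B *v (y - x)" i] K(2)[of "y - x"] by linarith
      also have "\<dots> \<le> K * exp (- t * n)"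
        using y(2) n(2) K(1) by (intro mult_left_mono) (auto simp: dist_norm norm_minus_commute)
      finally show ?thesis using M[of i] unfolding near_periodic_def by blast
    qed
    have "infinite {n. n \<ge> 1 \<and> (torus_map A ^^ n) X \<in> ball X (psi n)}"
      using X by (simp add: recurrence_set_def)
    then have "\<exists>\<^sub>F n in sequentially. n \<ge> 1 \<and> (torus_map A ^^ n) X \<in> ball X (psi n)"
      by (simp add: frequently_cofinite flip: cofinite_eq_sequentially)
    then have "\<exists>\<^sub>F n in sequentially. (n \<ge> 1 \<and> (torus_map A ^^ n) X \<in> ball X (psi n)) \<and> psi n \<le> exp (- t * n)"
      using psi by (rule frequently_eventually_frequently)
    then have "\<exists>\<^sub>F n in sequentially. \<forall>i. (B *v x) $ i \<in> near_periodic (\<mu> i) M (K * exp (- t * n)) n"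
      by (rule frequently_elim1) (use near in blast)
    then have "B *v x \<in> E" by (simp add: E_def)
    moreover have "g (B *v x) = X" by (simp add: g_def x matrix_vector_mul_assoc B')
    ultimately show "X \<in> g ` E" by blast
  qed
  ultimately show ?thesis using hausdorff_null_mono[OF s] by blast
qed

text \<open>
The map \<open>y \<mapsto> B y\<close> modulo the lattice sends the Cantor set of \<open>recurrent_cantor_set\<close> into the recurrence set, and on
a small box its inverse is Lipschitz. A null image would make the Cantor set null.
\<close>
lemma recurrence_set_hausdorff_pos:
  fixes A :: "int ^ 'n ^ 'n" and B :: "real ^ 'n ^ 'n" and \<mu> :: "'n \<Rightarrow> int"
  defines "l \<equiv> \<lambda>i. ln \<bar>real_of_int (\<mu> i)\<bar>"
  assumes \<mu>: "\<And>i. 2 \<le> \<bar>\<mu> i\<bar>" and B: "invertible B" "\<And>i j. B $ i $ j \<in> \<int>"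
    and AB: "\<And>y. map_matrix of_int A *v (B *v y) = B *v (\<chi> i. of_int (\<mu> i) * y $ i)"
    and a: "0 < a" and psi: "\<exists>\<^sub>F n in sequentially. exp (- a * real n) \<le> psi n" and s: "0 < s"
    and crit: "\<And>j. s * (l j + a) < (\<Sum>i\<in>UNIV. mass_exponent a (l i) (l j + a))"
  shows "hausdorff_measure s (recurrence_set (torus_map A) psi) \<noteq> 0"
proof
  assume null: "hausdorff_measure s (recurrence_set (torus_map A) psi) = 0"
  obtain B' where B': "B' ** B = mat 1" using B(1) unfolding invertible_def by blast
  obtain K where K: "0 < K" "\<And>x. norm (B *v x) \<le> K * norm x" using matrix_vector_norm_bound[of B] by blast
  obtain K' where K': "0 < K'" "\<And>x. norm (B' *v x) \<le> K' * norm x" using matrix_vector_norm_bound[of B'] by blast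
  let ?d = "real CARD('n)"
  \<comment> \<open>This choice serves twice: errors of size \<open>c * exp (- a * n)\<close> stay below \<open>\<psi>(n)\<close> after applying \<open>B\<close>, and \<open>B\<close>
    maps a box of side \<open>c\<close> to a set of diameter at most \<open>1 / 2\<close>.\<close>
  define c where "c = 1 / (2 * (K * ?d + 1))"
  have Kd: "0 < K * ?d" using K(1) by simp
  have c: "0 < c" "c < 1" "K * (?d * c) \<le> 1 / 2" using Kd by (auto simp: c_def field_simps)
  have l1: "norm y \<le> ?d * b" if "\<And>i. \<bar>y $ i\<bar> \<le> b" for y :: "real ^ 'n" and b
    using norm_le_l1_cart[of y] sum_bounded_above[of UNIV "\<lambda>i. \<bar>y $ i\<bar>" b] that by simp
  define Q where "Q = {n. n \<ge> 1 \<and> exp (- a * real n) \<le> psi n}"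
  have Q: "infinite Q"
  proof -
    have "\<exists>\<^sub>F n in sequentially. exp (- a * real n) \<le> psi n \<and> n \<ge> 1"
      using psi eventually_ge_at_top by (rule frequently_eventually_frequently)
    then show ?thesis unfolding Q_def by (simp add: frequently_cofinite conj_commute flip: cofinite_eq_sequentially)
  qed
  obtain E :: "(real ^ 'n) set" where E: "hausdorff_measure s E \<noteq> 0"
    "\<And>y i. y \<in> E \<Longrightarrow> y $ i \<in> {0..c}"
    "\<And>y. y \<in> E \<Longrightarrow> \<exists>\<^sub>F n in sequentially. n \<in> Q \<and>
       (\<forall>i. \<exists>z :: int. \<bar>(of_int (\<mu> i) ^ n - 1) * y $ i - z\<bar> \<le> c * exp (- a * n))"
    using recurrent_cantor_set[OF \<mu> a c(1,2) Q s crit[unfolded l_def]] by blast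
  define g where "g y = torus_of (B *v y)" for y
  have "g ` E \<subseteq> recurrence_set (torus_map A) psi"
  proof clarify
    fix y assume y: "y \<in> E"
    have power: "((*v) (map_matrix real_of_int A) ^^ n) (B *v y) = B *v (\<chi> i. of_int (\<mu> i) ^ n * y $ i)" for n
      by (induction n) (simp_all add: AB mult_ac)
    have near: "(torus_map A ^^ n) (g y) \<in> ball (g y) (psi n)"
      if n: "n \<in> Q" "\<forall>i. \<exists>z :: int. \<bar>(of_int (\<mu> i) ^ n - 1) * y $ i - z\<bar> \<le> c * exp (- a * n)" for n
    proof -
      obtain z where z: "\<And>i. \<bar>(of_int (\<mu> i) ^ n - 1) * y $ i - of_int (z i)\<bar> \<le> c * exp (- a * n)"
        using n(2) by metis
      let ?w = "(\<chi> i. of_int (\<mu> i) ^ n * y $ i) :: real ^ 'n"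
      let ?z = "(\<chi> i. of_int (z i)) :: real ^ 'n"
      have "B *v ?z \<in> int_lattice" by (intro int_matrix_int_lattice B) (simp add: int_lattice_def)
      then have eq: "torus_of (B *v ?w) = torus_of (B *v (?w - ?z))"
        by (simp add: torus_of_eq_iff matrix_vector_mult_diff_distrib)
      have "dist (g y) ((torus_map A ^^ n) (g y)) \<le> dist (B *v y) (B *v (?w - ?z))"
        unfolding g_def torus_map_power_torus_of power eq by (rule dist_torus_of_le)
      also have "\<dots> = norm (B *v (?w - ?z - y))"
        by (simp add: dist_norm norm_minus_commute matrix_vector_mult_diff_distrib)
      also have "\<dots> \<le> K * norm (?w - ?z - y)" by (rule K)
      also have "\<dots> \<le> K * (?d * (c * exp (- a * n)))"
        using K(1) z by (intro mult_left_mono l1) (simp_all add: algebra_simps)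
      also have "\<dots> = (K * (?d * c)) * exp (- a * n)" by simp
      also have "\<dots> \<le> 1 / 2 * exp (- a * n)" using c(3) by (intro mult_right_mono) auto
      also have "\<dots> < exp (- a * n)" by simp
      also have "\<dots> \<le> psi n" using n(1) by (simp add: Q_def)
      finally show ?thesis by simp
    qed
    have "\<exists>\<^sub>F n in sequentially. n \<ge> 1 \<and> (torus_map A ^^ n) (g y) \<in> ball (g y) (psi n)"
      using E(3)[OF y] by (rule frequently_elim1) (use near in \<open>auto simp: Q_def\<close>)
    then show "g y \<in> recurrence_set (torus_map A) psi"
      by (simp add: recurrence_set_def frequently_cofinite flip: cofinite_eq_sequentially)
  qed
  then have null_g: "hausdorff_measure s (g ` E) = 0" by (rule hausdorff_null_mono[OF s null])
  have expand: "dist y y' \<le> K' * dist (g y) (g y')" if y: "y \<in> E" "y' \<in> E" for y y'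
  proof -
    have "\<bar>(y - y') $ i\<bar> \<le> c" for i using E(2)[OF y(1), of i] E(2)[OF y(2), of i] by auto
    then have "norm (y - y') \<le> ?d * c" by (rule l1)
    then have "K * norm (y - y') \<le> K * (?d * c)" using K(1) by (intro mult_left_mono) auto
    then have "norm (B *v (y - y')) \<le> 1 / 2" using K(2)[of "y - y'"] c(3) by linarith
    then have half: "dist (B *v y) (B *v y') \<le> 1 / 2" by (simp add: dist_norm matrix_vector_mult_diff_distrib)
    have "y - y' = B' *v (B *v (y - y'))" by (simp add: matrix_vector_mul_assoc B')
    then have "dist y y' \<le> K' * norm (B *v (y - y'))" unfolding dist_norm using K'(2) by metis
    also have "\<dots> = K' * dist (B *v y) (B *v y')" by (simp add: dist_norm matrix_vector_mult_diff_distrib)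
    also have "\<dots> \<le> K' * dist (g y) (g y')"
      unfolding g_def using K'(1) dist_le_dist_torus_of[OF half] by (intro mult_left_mono) auto
    finally show ?thesis .
  qed
  then have inj: "inj_on g E" by (force simp: inj_on_def)
  have "K'-lipschitz_on (g ` E) (the_inv_into E g)"
    by (rule lipschitz_onI) (use expand K' inj in \<open>auto simp: the_inv_into_f_f\<close>)
  with s null_g have "hausdorff_measure s (the_inv_into E g ` g ` E) = 0"
    by (rule hausdorff_null_lipschitz_image)
  moreover have "the_inv_into E g ` g ` E = E"
    using inj by (simp add: the_inv_into_onto)
  ultimately show False using E(1) by simp
qed

section \<open>Decay rates and the dimension formula\<close>

lemma psi_le_exp_if_less_liminf:
  assumes pos: "\<And>n. n \<ge> 1 \<Longrightarrow> 0 < psi n"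
    and t: "ereal t < liminf (\<lambda>n. ereal (- ln (psi n) / real n))"
  shows "\<forall>\<^sub>F n in sequentially. psi n \<le> exp (- t * real n)"
  using less_LiminfD[OF t] eventually_ge_at_top[of 1]
proof eventually_elim
  case (elim n)
  then have "t < - ln (psi n) / real n" "0 < real n" by simp_all
  then have "t * real n < - ln (psi n)" by (simp only: pos_less_divide_eq)
  then have "exp (ln (psi n)) \<le> exp (- t * real n)" by simp
  then show ?case using pos[OF elim(2)] by simp
qed

lemma exp_le_psi_if_liminf_less:
  assumes pos: "\<And>n. n \<ge> 1 \<Longrightarrow> 0 < psi n"
    and a: "liminf (\<lambda>n. ereal (- ln (psi n) / real n)) < ereal a"
  shows "\<exists>\<^sub>F n in sequentially. exp (- a * real n) \<le> psi n"
proof (rule ccontr)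
  assume "\<not> (\<exists>\<^sub>F n in sequentially. exp (- a * real n) \<le> psi n)"
  then have "\<forall>\<^sub>F n in sequentially. psi n < exp (- a * real n)"
    by (simp add: not_frequently not_le)
  then have "\<forall>\<^sub>F n in sequentially. ereal a \<le> ereal (- ln (psi n) / real n)"
    using eventually_ge_at_top[of 1]
  proof eventually_elim
    case (elim n)
    then have "ln (psi n) \<le> ln (exp (- a * real n))" using pos[of n] by (subst ln_le_cancel_iff) auto
    then have "a * real n \<le> - ln (psi n)" by simp
    moreover have "0 < real n" using elim(2) by simp
    ultimately have "a \<le> - ln (psi n) / real n" by (simp only: pos_le_divide_eq)
    then show ?case by simp
  qed
  then have "ereal a \<le> liminf (\<lambda>n. ereal (- ln (psi n) / real n))" by (rule Liminf_bounded)
  then show False using a by simp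
qed

lemma liminf_decay_rate_nonneg:
  assumes pos: "\<And>n. n \<ge> 1 \<Longrightarrow> 0 < psi n" and lim: "psi \<longlonglongrightarrow> 0"
  shows "0 \<le> liminf (\<lambda>n. ereal (- ln (psi n) / real n))"
proof (rule Liminf_bounded)
  have "\<forall>\<^sub>F n in sequentially. psi n < 1" using order_tendstoD(2)[OF lim, of 1] by simp
  then show "\<forall>\<^sub>F n in sequentially. 0 \<le> ereal (- ln (psi n) / real n)"
    using eventually_ge_at_top[of 1]
  proof eventually_elim
    case (elim n)
    then have "ln (psi n) \<le> 0" using pos[of n] by (simp add: ln_le_zero_iff)
    then show ?case by (simp add: divide_nonpos_nonneg)
  qed
qed

text \<open>
At \<open>u = l j + a\<close> the exponent of coordinate \<open>i\<close> is \<open>l j\<close> for \<open>i \<le> j\<close>. For \<open>i > j\<close> it is \<open>l i\<close>, cut off at \<open>l j + a\<close>; the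
cut-off happens exactly for \<open>i \<in> K(j)\<close>, and the sum over that set corrects it.
\<close>
lemma dim_numerator_eq:
  fixes l :: "nat \<Rightarrow> real"
  assumes a: "0 \<le> a" and mono: "\<And>i j. 1 \<le> i \<Longrightarrow> i \<le> j \<Longrightarrow> j \<le> d \<Longrightarrow> l i \<le> l j" and j: "j \<in> {1..d}"
  shows "real j * l j + (\<Sum>i\<in>{i \<in> {1..d}. l i > l j + a}. a + l j - l i) + (\<Sum>i = j + 1..d. l i)
    = (\<Sum>i = 1..d. mass_exponent a (l i) (l j + a))"
proof -
  have split: "{1..d} = {1..j} \<union> {j + 1..d}" using j by auto
  have low: "mass_exponent a (l i) (l j + a) = l j" if "i \<in> {1..j}" for i
    using mono[of i j] that j a by (auto simp: mass_exponent_def)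
  have high: "mass_exponent a (l i) (l j + a) = l i + (if l i > l j + a then a + l j - l i else 0)"
    if "i \<in> {j + 1..d}" for i
    using mono[of j i] that j a by (auto simp: mass_exponent_def)
  have K: "{i \<in> {1..d}. l i > l j + a} = {i \<in> {j + 1..d}. l i > l j + a}"
    using mono[of _ j] j a by (force simp: not_less_eq_eq)
  have "(\<Sum>i = 1..d. mass_exponent a (l i) (l j + a)) =
      (\<Sum>i = 1..j. mass_exponent a (l i) (l j + a)) + (\<Sum>i = j + 1..d. mass_exponent a (l i) (l j + a))"
    unfolding split by (rule sum.union_disjoint) auto
  also have "\<dots> = (\<Sum>i = 1..j. l j) + (\<Sum>i = j + 1..d. l i + (if l i > l j + a then a + l j - l i else 0))"
    by (intro arg_cong2[of _ _ _ _ "(+)"] sum.cong refl low high)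
  also have "\<dots> = real j * l j + (\<Sum>i = j + 1..d. l i) + (\<Sum>i\<in>{i \<in> {j + 1..d}. l i > l j + a}. a + l j - l i)"
    by (simp only: sum.distrib sum.inter_filter finite_atLeastAtMost) simp
  finally show ?thesis unfolding K by linarith
qed

text \<open>
The numerator of the dimension formula as a function of the rate \<open>a\<close>: a finite sum of continuous functions, so
that no index set jumps with \<open>a\<close>.
\<close>
definition covering_exponent :: "nat \<Rightarrow> (nat \<Rightarrow> int) \<Rightarrow> real \<Rightarrow> nat \<Rightarrow> real" where
  "covering_exponent d lam a j =
    (\<Sum>i = 1..d. mass_exponent a (ln \<bar>real_of_int (lam i)\<bar>) (ln \<bar>real_of_int (lam j)\<bar> + a))"

lemma dim_term_eq_covering_exponent:
  assumes a: "0 \<le> a" and mono: "mono_on {1..d} (\<lambda>i. \<bar>lam i\<bar>)" and gt1: "\<And>i. i \<in> {1..d} \<Longrightarrow> 1 < \<bar>lam i\<bar>"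
    and j: "j \<in> {1..d}"
  shows "dim_term d lam (ereal a) j =
    ereal (covering_exponent d lam a j / (ln \<bar>real_of_int (lam j)\<bar> + a))"
proof -
  have ln_mono: "ln \<bar>real_of_int (lam i)\<bar> \<le> ln \<bar>real_of_int (lam k)\<bar>" if "1 \<le> i" "i \<le> k" "k \<le> d" for i k
  proof -
    have "\<bar>lam i\<bar> \<le> \<bar>lam k\<bar>" using mono that by (simp add: mono_on_def)
    then have "\<bar>real_of_int (lam i)\<bar> \<le> \<bar>real_of_int (lam k)\<bar>" by linarith
    then show ?thesis using gt1[of i] that by (intro ln_mono) auto
  qed
  have eq: "real j * ln \<bar>real_of_int (lam j)\<bar>
      + (\<Sum>i\<in>{i \<in> {1..d}. ln \<bar>real_of_int (lam i)\<bar> > ln \<bar>real_of_int (lam j)\<bar> + a}.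
          a + ln \<bar>real_of_int (lam j)\<bar> - ln \<bar>real_of_int (lam i)\<bar>)
      + (\<Sum>i = j + 1..d. ln \<bar>real_of_int (lam i)\<bar>) = covering_exponent d lam a j"
    unfolding covering_exponent_def by (rule dim_numerator_eq[OF a ln_mono j])
  show ?thesis
    unfolding dim_term_real[where lam = lam, OF a gt1[OF j]] eq by (simp only: add.commute)
qed

lemma tendsto_covering_exponent:
  "((\<lambda>a. covering_exponent d lam a j) \<longlongrightarrow> covering_exponent d lam a0 j) (at a0 within S)"
  unfolding covering_exponent_def mass_exponent_def by (intro tendsto_intros)

lemma covering_exponent_bounded:
  assumes "0 \<le> a"
  shows "covering_exponent d lam a j \<le> (\<Sum>i = 1..d. max (ln \<bar>real_of_int (lam i)\<bar>) (ln \<bar>real_of_int (lam j)\<bar>))"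
  unfolding covering_exponent_def using assms by (intro sum_mono) (auto simp: mass_exponent_def)

theorem theorem1p5:
  fixes A :: "int ^ 'n ^ 'n" and lam :: "nat \<Rightarrow> int"
    and psi :: "nat \<Rightarrow> real" and \<alpha> :: ereal
  assumes "diagonalizable (map_matrix rat_of_int A)"
    and "charpoly A = (\<Prod>i = 1..CARD('n). [:- lam i, 1:])"
    and "1 < \<bar>lam 1\<bar>" and "mono_on {1..CARD('n)} (\<lambda>i. \<bar>lam i\<bar>)"
    and "\<And>n. n \<ge> 1 \<Longrightarrow> 0 < psi n" and "antimono_on {1..} psi" and "psi \<longlonglongrightarrow> 0"
    and "\<alpha> = liminf (\<lambda>n. ereal (- ln (psi n) / real n))"
  shows "hausdorff_dim (recurrence_set (torus_map A) psi) =
    (MIN j\<in>{1..CARD('n)}. dim_term CARD('n) lam \<alpha> j)"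
proof -
  define d where "d = CARD('n)"
  define l where "l j = ln \<bar>real_of_int (lam j)\<bar>" for j
  define R where "R = recurrence_set (torus_map A) psi"
  obtain \<tau> :: "'n \<Rightarrow> nat" and B B' :: "real ^ 'n ^ 'n" where \<tau>: "bij_betw \<tau> UNIV {1..d}"
    and inv: "invertible B" "invertible B'" and int: "\<And>i j. B $ i $ j \<in> \<int>" "\<And>i j. B' $ i $ j \<in> \<int>"
    and conj: "\<And>x. B *v (map_matrix of_int A *v x) = (\<chi> i. of_int (lam (\<tau> i)) * (B *v x) $ i)"
      "\<And>y. map_matrix of_int A *v (B' *v y) = B' *v (\<chi> i. of_int (lam (\<tau> i)) * y $ i)"
    using integer_eigenbases[OF assms(1,2)] unfolding d_def by blast
  have gt1: "1 < \<bar>lam i\<bar>" if "i \<in> {1..d}" for i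
  proof -
    have "\<bar>lam 1\<bar> \<le> \<bar>lam i\<bar>" using assms(4) that unfolding mono_on_def d_def by auto
    then show ?thesis using assms(3) by simp
  qed
  have \<tau>_in: "\<tau> i \<in> {1..d}" for i using \<tau> by (auto simp: bij_betw_def)
  have lam2: "2 \<le> \<bar>lam (\<tau> i)\<bar>" for i using gt1[OF \<tau>_in[of i]] by linarith
  have l_pos: "0 < l i" if "i \<in> {1..d}" for i
  proof -
    have "1 < \<bar>real_of_int (lam i)\<bar>" using gt1[OF that] by linarith
    then show ?thesis by (simp add: l_def)
  qed
  have sum\<tau>: "(\<Sum>i\<in>UNIV. mass_exponent a (ln \<bar>real_of_int (lam (\<tau> i))\<bar>) (ln \<bar>real_of_int (lam j)\<bar> + a)) =
      covering_exponent d lam a j" for a j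
    unfolding covering_exponent_def
    using sum.reindex_bij_betw[OF \<tau>, of "\<lambda>i. mass_exponent a (ln \<bar>real_of_int (lam i)\<bar>) (ln \<bar>real_of_int (lam j)\<bar> + a)"] .

  have null: "hausdorff_measure s R = 0"
    if "0 \<le> t" "\<forall>\<^sub>F n in sequentially. psi n \<le> exp (- t * real n)" "0 < s"
      "j \<in> {1..d}" "covering_exponent d lam t j < s * (l j + t)" for t s j
  proof -
    have "j \<in> range \<tau>" using \<tau> \<open>j \<in> {1..d}\<close> by (simp only: bij_betw_def)
    then obtain i where i: "j = \<tau> i" by blast
    show ?thesis unfolding R_def
      by (rule recurrence_set_hausdorff_null[OF lam2 inv(1) int(1) conj(1) that(1-3), of i])
        (use that(5) in \<open>simp add: i sum\<tau> l_def\<close>)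
  qed
  have pos: "hausdorff_measure s R \<noteq> 0"
    if "0 < a" "\<exists>\<^sub>F n in sequentially. exp (- a * real n) \<le> psi n" "0 < s"
      "\<And>j. j \<in> {1..d} \<Longrightarrow> s * (l j + a) < covering_exponent d lam a j" for a s
    unfolding R_def
    by (rule recurrence_set_hausdorff_pos[OF lam2 inv(2) int(2) conj(2) that(1-3)])
      (use that(4)[OF \<tau>_in] in \<open>simp add: sum\<tau> l_def\<close>)

  have \<alpha>0: "0 \<le> \<alpha>" unfolding assms(8) using assms(5,7) by (rule liminf_decay_rate_nonneg)
  have dim_le: "hausdorff_dim R \<le> ereal s" if "0 < s" "hausdorff_measure s R = 0" for s
    unfolding hausdorff_dim_def using that by (intro Inf_lower) auto

  have upper: "hausdorff_dim R \<le> dim_term d lam \<alpha> j" if j: "j \<in> {1..d}" for j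
  proof (rule dense_ge)
    fix z assume z: "dim_term d lam \<alpha> j < z"
    show "hausdorff_dim R \<le> z"
    proof (cases z)
      case (real s)
      show ?thesis
      proof (cases \<alpha>)
        case (real a)
        have a: "0 \<le> a" using \<alpha>0 real by simp
        have "ereal (covering_exponent d lam a j / (l j + a)) < ereal s"
          using z dim_term_eq_covering_exponent[OF a assms(4)[folded d_def] gt1 j] \<open>\<alpha> = ereal a\<close> \<open>z = ereal s\<close>
          by (simp add: l_def)
        then have less: "covering_exponent d lam a j < s * (l j + a)"
          using l_pos[OF j] a by (simp add: pos_divide_less_eq)
        have "0 \<le> covering_exponent d lam a j"
          unfolding covering_exponent_def using l_pos[OF j]
          by (intro sum_nonneg) (simp add: mass_exponent_def l_def)
        then have s: "0 < s" using less l_pos[OF j] a by (smt (verit) mult_nonpos_nonneg)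
        show ?thesis
        proof (cases "a = 0")
          case True
          \<comment> \<open>There is no nonnegative rate below \<open>\<alpha> = 0\<close>; the rate \<open>0\<close> itself works since \<open>\<psi>\<close> is eventually below \<open>1\<close>.\<close>
          have "\<forall>\<^sub>F n in sequentially. psi n < 1" using order_tendstoD(2)[OF assms(7), of 1] by simp
          then have "\<forall>\<^sub>F n in sequentially. psi n \<le> exp (- 0 * real n)" by eventually_elim simp
          then have "hausdorff_measure s R = 0" using less True s j by (intro null[of 0 s j]) auto
          then show ?thesis using dim_le[OF s] \<open>z = ereal s\<close> by simp
        next
          case False
          \<comment> \<open>A rate \<open>t < a\<close> so close to \<open>a\<close> that \<open>s\<close> is still above the critical value.\<close>
          have "((\<lambda>t. covering_exponent d lam t j - s * (l j + t)) \<longlongrightarrow>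
              covering_exponent d lam a j - s * (l j + a)) (at_left a)"
            by (intro tendsto_intros tendsto_covering_exponent)
          then have "\<forall>\<^sub>F t in at_left a. covering_exponent d lam t j - s * (l j + t) < 0"
            by (rule order_tendstoD) (use less in simp)
          moreover have "\<forall>\<^sub>F t in at_left a. t \<in> {0<..<a}"
            by (rule eventually_at_leftI[of 0]) (use a False in auto)
          ultimately have "\<forall>\<^sub>F t in at_left a. covering_exponent d lam t j - s * (l j + t) < 0 \<and> t \<in> {0<..<a}"
            by (rule eventually_conj)
          then obtain t where t: "covering_exponent d lam t j - s * (l j + t) < 0" "t \<in> {0<..<a}"
            using eventually_happens'[OF trivial_limit_at_left_real] by blast
          have "ereal t < liminf (\<lambda>n. ereal (- ln (psi n) / real n))"
            using t(2) \<open>\<alpha> = ereal a\<close> assms(8) by simp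
          then have "\<forall>\<^sub>F n in sequentially. psi n \<le> exp (- t * real n)"
            using assms(5) by (intro psi_le_exp_if_less_liminf)
          then have "hausdorff_measure s R = 0" using t s j by (intro null[of t s j]) auto
          then show ?thesis using dim_le[OF s] \<open>z = ereal s\<close> by simp
        qed
      next
        case PInf
        then have s: "0 < s" using z \<open>z = ereal s\<close> by (simp add: dim_term_infinity)
        define b where "b = (\<Sum>i = 1..d. max (ln \<bar>real_of_int (lam i)\<bar>) (ln \<bar>real_of_int (lam j)\<bar>))"
        \<comment> \<open>For \<open>\<alpha> = \<infinity>\<close> any rate is admissible, while the covering exponent stays bounded by \<open>b\<close>.\<close>
        define t where "t = max 0 (b / s)"
        have t: "0 \<le> t" "b \<le> s * t" using s by (auto simp: t_def max_def field_simps)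
        have "ereal t < liminf (\<lambda>n. ereal (- ln (psi n) / real n))" using PInf assms(8) by simp
        then have "\<forall>\<^sub>F n in sequentially. psi n \<le> exp (- t * real n)"
          using assms(5) by (intro psi_le_exp_if_less_liminf)
        moreover have "covering_exponent d lam t j < s * (l j + t)"
        proof -
          have "0 < s * l j" using s l_pos[OF j] by simp
          then show ?thesis
            using covering_exponent_bounded[OF t(1), of d lam j] t(2) by (simp add: b_def distrib_left)
        qed
        ultimately have "hausdorff_measure s R = 0" using t s j by (intro null[of t s j]) auto
        then show ?thesis using dim_le[OF s] \<open>z = ereal s\<close> by simp
      next
        case MInf
        then show ?thesis using \<alpha>0 by simp
      qed
    qed (use z in auto)
  qed

  have lower: "(MIN j\<in>{1..d}. dim_term d lam \<alpha> j) \<le> ereal s"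
    if s: "0 \<le> s" "hausdorff_measure s R = 0" for s
  proof (rule ccontr)
    assume "\<not> (MIN j\<in>{1..d}. dim_term d lam \<alpha> j) \<le> ereal s"
    moreover have "finite {1..d}" "{1..d} \<noteq> {}" by (auto simp: d_def Suc_le_eq)
    ultimately have less: "ereal s < dim_term d lam \<alpha> j" if "j \<in> {1..d}" for j
      using that by (auto simp: not_le)
    have one: "1 \<in> {1..d}" by (auto simp: d_def Suc_le_eq)
    \<comment> \<open>The fixed point \<open>0\<close> keeps the recurrence set nonempty, which excludes \<open>s = 0\<close>.\<close>
    have "torus_of 0 \<in> R"
    proof -
      have "((*v) (map_matrix real_of_int A) ^^ n) 0 = 0" for n by (induction n) simp_all
      then have "{n. n \<ge> 1 \<and> (torus_map A ^^ n) (torus_of 0) \<in> ball (torus_of 0) (psi n)} = {1..}"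
        using assms(5) by (auto simp: torus_map_power_torus_of)
      then show ?thesis by (simp add: R_def recurrence_set_def infinite_Ici)
    qed
    then have "s \<noteq> 0" using s(2) hausdorff_measure_zero_eq_0_iff[of R] by auto
    then have s0: "0 < s" using s(1) by simp
    obtain a where \<alpha>: "\<alpha> = ereal a"
      using less[OF one] \<alpha>0 s(1) by (cases \<alpha>) (auto simp: dim_term_infinity)
    have a: "0 \<le> a" using \<alpha>0 \<alpha> by simp
    have "\<forall>\<^sub>F b in at_right a. 0 < covering_exponent d lam b j - s * (l j + b)" if j: "j \<in> {1..d}" for j
    proof (rule order_tendstoD)
      show "((\<lambda>b. covering_exponent d lam b j - s * (l j + b)) \<longlongrightarrow>
          covering_exponent d lam a j - s * (l j + a)) (at_right a)"
        by (intro tendsto_intros tendsto_covering_exponent)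
      have "ereal s < ereal (covering_exponent d lam a j / (l j + a))"
        using less[OF j] dim_term_eq_covering_exponent[OF a assms(4)[folded d_def] gt1 j] \<alpha> by (simp add: l_def)
      then show "0 < covering_exponent d lam a j - s * (l j + a)"
        using l_pos[OF j] a by (simp add: pos_less_divide_eq)
    qed
    \<comment> \<open>A rate \<open>b > \<alpha>\<close> so close to \<open>\<alpha>\<close> that \<open>s\<close> is still below all critical values.\<close>
    then have "\<forall>\<^sub>F b in at_right a. \<forall>j\<in>{1..d}. 0 < covering_exponent d lam b j - s * (l j + b)"
      by (intro eventually_ball_finite) auto
    then have "\<forall>\<^sub>F b in at_right a. a < b \<and> (\<forall>j\<in>{1..d}. 0 < covering_exponent d lam b j - s * (l j + b))"
      by (intro eventually_conj eventually_at_right_less)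
    then obtain b where b: "a < b" "\<forall>j\<in>{1..d}. 0 < covering_exponent d lam b j - s * (l j + b)"
      using eventually_happens'[OF trivial_limit_at_right_real] by blast
    have "\<exists>\<^sub>F n in sequentially. exp (- b * real n) \<le> psi n"
      using assms(5) by (rule exp_le_psi_if_liminf_less) (use b(1) \<alpha> assms(8) in simp_all)
    then have "hausdorff_measure s R \<noteq> 0" using b a s0 by (intro pos[of b s]) auto
    then show False using s(2) by simp
  qed

  have "hausdorff_dim R = (MIN j\<in>{1..d}. dim_term d lam \<alpha> j)"
  proof (rule antisym)
    show "hausdorff_dim R \<le> (MIN j\<in>{1..d}. dim_term d lam \<alpha> j)"
      by (rule Min.boundedI) (use upper in \<open>auto simp: d_def Suc_le_eq\<close>)
    show "(MIN j\<in>{1..d}. dim_term d lam \<alpha> j) \<le> hausdorff_dim R"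
      unfolding hausdorff_dim_def by (rule Inf_greatest) (use lower in auto)
  qed
  then show ?thesis by (simp only: R_def d_def)
qed

end
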